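(* The maps $\mathfrak s^{PT}$, $\mathrm{flat}_1$, $\mathrm{flat}_0$, $\mathfrak s$ restrict to maps $\mathfrak s^{PT}:\mathcal{PT}^{\mathrm{conv}}_{\mathbb N^*}\to\mathcal{PT}^{\mathrm{conv}}_{\{x,y\}}$, $\mathrm{flat}_1:\mathcal{PT}^{\mathrm{conv}}_{\mathbb N^*}\to\mathcal W^{\mathrm{conv}}_{\mathbb N^*}$, $\mathrm{flat}_0:\mathcal{PT}^{\mathrm{conv}}_{\{x,y\}}\to\mathcal W^{\mathrm{conv}}_{\{x,y\}}$, $\mathfrak s:\mathcal W^{\mathrm{conv}}_{\mathbb N^*}\to\mathcal W^{\mathrm{conv}}_{\{x,y\}}$, and the resulting square commutes: $$\mathrm{flat}_0\circ\mathfrak s^{PT}=\mathfrak s\circ\mathrm{flat}_1\quad\text{on }\mathcal{PT}^{\mathrm{conv}}_{\mathbb N^*}.$$ Furthermore, arborified zeta values admit an iterated integral representation through $\mathfrak s^{PT}$: $$\forall\,T\in\mathcal{PT}^{\mathrm{conv}}_{\mathbb N^*},\qquad \zeta^T(T)=\zeta^T_{\mathrm{sh}}\circ\mathfrak s^{PT}(T).$$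
   Context: $\mathbb K$ is a subfield of $\mathbb R$ (e.g. $\mathbb Q$); $\mathbb N^*=\{1,2,3,\dots\}$. Words. $\mathcal W_A$ is the $\mathbb K$-vector space with basis the words over $A$, including the empty word $\emptyset$. On $\mathcal W_{\{x,y\}}$, $\mathrm{sh}$ is the bilinear product with unit $\emptyset$ and $au\mathbin{\mathrm{sh}}bv=a(u\mathbin{\mathrm{sh}}bv)+b(au\mathbin{\mathrm{sh}}v)$. On $\mathcal W_{\mathbb N^*}$, $\mathrm{qsh}$ is the bilinear product with unit $\emptyset$ and $au\mathbin{\mathrm{qsh}}bv=a(u\mathbin{\mathrm{qsh}}bv)+b(au\mathbin{\mathrm{qsh}}v)+(a+b)(u\mathbin{\mathrm{qsh}}v)$. $\mathfrak s:\mathcal W_{\mathbb N^*}\to\mathcal W_{\{x,y\}}$ is the linear map $\mathfrak s(n_1\cdots n_p)=x^{n_1-1}y\cdots x^{n_p-1}y$, $\mathfrak s(\emptyset)=\emptyset$. $\mathcal W^{\mathrm{conv}}_{\mathbb N^*}$ is spanned by $\emptyset$ and the words not beginning with $1$; $\mathcal W^{\mathrm{conv}}_{\{x,y\}}$ by $\emptyset$ and the words beginning with $x$ and ending with $y$. Trees. Planar rooted trees are finite rooted trees with linearly ordered children at every vertex. $\mathrm{PT}_\Omega$ is the set of non-empty planar rooted trees with vertices decorated by $\Omega$, $\mathcal{PT}_\Omega$ the vector space with basis $\mathrm{PT}_\Omega$. $B_+^a(T_1\cdots T_k)$ grafts $T_1,\dots,T_k$ in this order on a new root decorated by $a$ (extended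 multilinearly); $B_+^a(\emptyset)$ is the one-vertex tree. Forests are finite, possibly empty, sequences of trees. A ladder tree is one in which every vertex has at most one child. $\mathrm{flat}_1:\mathcal{PT}_{\mathbb N^*}\to\mathcal W_{\mathbb N^*}$ and $\mathrm{flat}_0:\mathcal{PT}_{\{x,y\}}\to\mathcal W_{\{x,y\}}$ are the linear maps with $\mathrm{flat}_1(B_+^n(t_1\cdots t_k))=n\,(\mathrm{flat}_1(t_1)\mathbin{\mathrm{qsh}}\cdots\mathbin{\mathrm{qsh}}\mathrm{flat}_1(t_k))$ and $\mathrm{flat}_0(B_+^\epsilon(t_1\cdots t_k))=\epsilon\,(\mathrm{flat}_0(t_1)\mathbin{\mathrm{sh}}\cdots\mathbin{\mathrm{sh}}\mathrm{flat}_0(t_k))$ (concatenation of the first letter with the product; the empty product is $\emptyset$). Arborified zeta values. $V(t)$ is partially ordered with the root as minimum. $\mathcal{PT}^{\mathrm{conv}}_{\mathbb N^*}$ is spanned by the trees whose root is not decorated by $1$, and $\zeta^T(t)=\sum\prod_{v\in V(t)}k_v^{-n_v}$ over $(k_v)\in(\mathbb N^* )^{V(t)}$ with $k_v<k_u$ whenever $u<v$ ($n_v$ the decoration of $v$). $\mathcal{PT}^{\mathrm{conv}}_{\{x,y\}}$ is spanned by the trees whose root is decorated by $x$ and all of whose leaves are decorated by $y$, and $\zeta^T_{\mathrm{sh}}(t)=\int_{\Delta_t}\prod_{v\in V(t)}g_{d_v}(t_v)\,dt_v$ with $\Delta_t=\{(t_v)\in[0,1]^{V(t)}:t_u>t_v\text{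 whenever }u<v\}$, $d_v$ the decoration of $v$, $g_x(\tau)=1/\tau$, $g_y(\tau)=1/(1-\tau)$. Both converge and are extended linearly. Binarisation. $\mathfrak s^{PN}:\mathcal{PT}_{\mathbb N^*}\to\mathcal{PT}_{\{x,y\}}$ is linear with $\mathfrak s^{PN}(B_+^n(T_1\cdots T_k))=(B_+^x)^{\circ(n-1)}\circ B_+^y(\mathfrak s^{PN}(T_1)\cdots\mathfrak s^{PN}(T_k))$. A non-ladder tree $T\in\mathrm{PT}_{\mathbb N^*}$ is uniquely $T=B\big(B_+^{n_a}(F_a)B_+^{n_b}(F_b)F\big)$ with $B=B_+^{n_1}\circ\cdots\circ B_+^{n_p}$, $p\ge1$, and $F_a,F_b,F$ possibly empty forests. Set $T^a_b:=B(B_+^{n_a}(B_+^{n_b}(F_b)F_a)F)$, $T^b_a:=B(B_+^{n_b}(B_+^{n_a}(F_a)F_b)F)$, $T_{a+b}:=B(B_+^{n_a+n_b}(F_aF_b)F)$. The process tree $\mathrm{pr}(T)$, with vertices decorated by trees (decoration map $\delta_{\mathrm{pr}(T)}$), is defined by the well-founded recursion: a single vertex decorated by $T$ if $T$ is a ladder tree; otherwise a root decorated by $T$ with children subtrees $\mathrm{pr}(T_{a+b}),\mathrm{pr}(T^a_b),\mathrm{pr}(T^b_a)$. Put $T^e=0$ if $T$ is a ladder tree and otherwise $$T^e=T_{a+b}-\sum_{i=1}^{n_a-1}\binom{n_a-i+n_b-1}{n_b-1}B\big(B_+^{n_a+n_b-i}(B_+^i(F_a)F_b)F\big)-\sum_{i=1}^{n_b-1}\binom{n_b-i+n_a-1}{n_a-1}B\big(B_+^{n_a+n_b-i}(B_+^i(F_b)F_a)F\big).$$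 Let $\phi(T)=T+\sum_{v\in V(\mathrm{pr}(T))}(\delta_{\mathrm{pr}(T)}(v))^e$ (extended linearly) and $\mathfrak s^{PT}:=\mathfrak s^{PN}\circ\phi$. *)

theory Defs
  imports
    "HOL-Analysis.Analysis"
    "HOL-Library.Poly_Mapping"
    "HOL-Library.Sublist"
begin

section \<open>Free vector spaces\<close>

definition real_subfield :: "real set \<Rightarrow> bool" where
  "real_subfield K \<longleftrightarrow>
     0 \<in> K \<and> 1 \<in> K \<and>
     (\<forall>a\<in>K. \<forall>b\<in>K. a + b \<in> K \<and> a * b \<in> K) \<and>
     (\<forall>a\<in>K. - a \<in> K \<and> inverse a \<in> K)"

text \<open>
  Since the ground field \<open>K\<close> is a subfield of the reals, every vector space with a basis is
  realised inside the real vector space of finitely supported functions: \<open>free_space K B\<close> is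
  the \<open>K\<close>-vector space with basis \<open>B\<close>, equivalently the \<open>K\<close>-span of \<open>B\<close>. The linear maps
  below are defined with real coefficients; all of them send basis vectors to combinations
  with integer coefficients, so that they restrict to \<open>K\<close>-linear maps.
\<close>

type_synonym 'a lc = "'a \<Rightarrow>\<^sub>0 real"

definition free_space :: "real set \<Rightarrow> 'a set \<Rightarrow> 'a lc set" where
  "free_space K B = {p. Poly_Mapping.keys p \<subseteq> B \<and> (\<forall>b. Poly_Mapping.lookup p b \<in> K)}"

abbreviation bvec :: "'a \<Rightarrow> 'a lc" where
  "bvec b \<equiv> Poly_Mapping.single b 1"

definition scale :: "real \<Rightarrow> 'a lc \<Rightarrow> 'a lc" where
  "scale c p = Poly_Mapping.map ((*) c) p"

definition lin_ext :: "('a \<Rightarrow> 'b lc) \<Rightarrow> 'a lc \<Rightarrow> 'b lc" where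
  "lin_ext f p = (\<Sum>b\<in>Poly_Mapping.keys p. scale (Poly_Mapping.lookup p b) (f b))"

definition bilin_ext :: "('a \<Rightarrow> 'b \<Rightarrow> 'c lc) \<Rightarrow> 'a lc \<Rightarrow> 'b lc \<Rightarrow> 'c lc" where
  "bilin_ext f p q = lin_ext (\<lambda>a. lin_ext (f a) q) p"

definition lin_val :: "('a \<Rightarrow> real) \<Rightarrow> 'a lc \<Rightarrow> real" where
  "lin_val f p = (\<Sum>b\<in>Poly_Mapping.keys p. Poly_Mapping.lookup p b * f b)"

lemma lookup_scale [simp]: "Poly_Mapping.lookup (scale c p) b = c * Poly_Mapping.lookup p b"
  unfolding scale_def by transfer (simp add: when_def)

lemma scale_one [simp]: "scale 1 p = p"
  by (rule poly_mapping_eqI) simp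

lemma lin_ext_single [simp]: "lin_ext f (bvec b) = f b"
  by (simp add: lin_ext_def)

lemma lin_val_single [simp]: "lin_val f (bvec b) = f b"
  by (simp add: lin_val_def)


section \<open>Words\<close>

datatype xy = Lx | Ly

definition prepend :: "'a \<Rightarrow> 'a list lc \<Rightarrow> 'a list lc" where
  "prepend a = lin_ext (\<lambda>w. bvec (a # w))"

fun sh_word :: "'a list \<Rightarrow> 'a list \<Rightarrow> 'a list lc" where
  "sh_word [] v = bvec v"
| "sh_word u [] = bvec u"
| "sh_word (a # u) (b # v) =
     prepend a (sh_word u (b # v)) + prepend b (sh_word (a # u) v)"

definition sh :: "'a list lc \<Rightarrow> 'a list lc \<Rightarrow> 'a list lc" where
  "sh = bilin_ext sh_word"

fun qsh_word :: "nat list \<Rightarrow> nat list \<Rightarrow> nat list lc" where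
  "qsh_word [] v = bvec v"
| "qsh_word u [] = bvec u"
| "qsh_word (a # u) (b # v) =
     prepend a (qsh_word u (b # v)) + prepend b (qsh_word (a # u) v)
     + prepend (a + b) (qsh_word u v)"

definition qsh :: "nat list lc \<Rightarrow> nat list lc \<Rightarrow> nat list lc" where
  "qsh = bilin_ext qsh_word"

definition s_word :: "nat list \<Rightarrow> xy list" where
  "s_word ns = concat (map (\<lambda>n. replicate (n - 1) Lx @ [Ly]) ns)"

definition s_map :: "nat list lc \<Rightarrow> xy list lc" where
  "s_map = lin_ext (\<lambda>w. bvec (s_word w))"

text \<open>
  Positive integers are represented by the type \<open>nat\<close>; positivity of all letters (and of all
  decorations of trees) is part of the bases below.
\<close>

definition W_N_conv :: "real set \<Rightarrow> nat list lc set" where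
  "W_N_conv K = free_space K {w. set w \<subseteq> {1..} \<and> (w = [] \<or> hd w \<noteq> 1)}"

definition W_xy_conv :: "real set \<Rightarrow> xy list lc set" where
  "W_xy_conv K = free_space K {w. w = [] \<or> (hd w = Lx \<and> last w = Ly)}"


section \<open>Planar rooted trees\<close>

datatype 'a ptree = Node (rootdec: 'a) (children: "'a ptree list")

text \<open>
  A vertex is represented by its address, i.e. the list of child positions on the path from
  the root to it. Hence \<open>u < v\<close> in the tree order (root minimal) means that \<open>u\<close> is a strict
  prefix of \<open>v\<close>.
\<close>

lemma size_nth_ptree [termination_simp]:
  "i < length ts \<Longrightarrow> size (ts ! i) < Suc (size_list size ts)"
  by (meson size_list_estimation' le_imp_less_Suc nth_mem order_refl)

fun verts :: "'a ptree \<Rightarrow> nat list set" where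
  "verts (Node a ts) = insert [] (\<Union>i\<in>{..<length ts}. (#) i ` verts (ts ! i))"

fun subtree_at :: "'a ptree \<Rightarrow> nat list \<Rightarrow> 'a ptree" where
  "subtree_at t [] = t"
| "subtree_at t (i # v) = subtree_at (children t ! i) v"

definition dec :: "'a ptree \<Rightarrow> nat list \<Rightarrow> 'a" where
  "dec t v = rootdec (subtree_at t v)"

definition leaves :: "'a ptree \<Rightarrow> nat list set" where
  "leaves t = {v \<in> verts t. children (subtree_at t v) = []}"

definition ladder :: "'a ptree \<Rightarrow> bool" where
  "ladder t \<longleftrightarrow> (\<forall>v\<in>verts t. length (children (subtree_at t v)) \<le> 1)"

definition PT_N_conv :: "real set \<Rightarrow> nat ptree lc set" where
  "PT_N_conv K = free_space K {t. (\<forall>v\<in>verts t. dec t v \<ge> 1) \<and> rootdec t \<noteq> 1}"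

definition PT_xy_conv :: "real set \<Rightarrow> xy ptree lc set" where
  "PT_xy_conv K = free_space K {t. rootdec t = Lx \<and> (\<forall>v\<in>leaves t. dec t v = Ly)}"

fun flat0_tree :: "xy ptree \<Rightarrow> xy list lc" where
  "flat0_tree (Node e ts) = prepend e (foldr sh (map flat0_tree ts) (bvec []))"

definition flat0 :: "xy ptree lc \<Rightarrow> xy list lc" where
  "flat0 = lin_ext flat0_tree"

fun flat1_tree :: "nat ptree \<Rightarrow> nat list lc" where
  "flat1_tree (Node n ts) = prepend n (foldr qsh (map flat1_tree ts) (bvec []))"

definition flat1 :: "nat ptree lc \<Rightarrow> nat list lc" where
  "flat1 = lin_ext flat1_tree"


section \<open>Arborified zeta values\<close>

definition zeta_T_tree :: "nat ptree \<Rightarrow> real" where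
  "zeta_T_tree t =
     (\<Sum>\<^sub>\<infinity>k\<in>{k \<in> verts t \<rightarrow>\<^sub>E {1::nat..}.
              \<forall>u\<in>verts t. \<forall>v\<in>verts t. strict_prefix u v \<longrightarrow> k v < k u}.
        \<Prod>v\<in>verts t. 1 / real (k v) ^ dec t v)"

definition zeta_T :: "nat ptree lc \<Rightarrow> real" where
  "zeta_T = lin_val zeta_T_tree"

fun g_form :: "xy \<Rightarrow> real \<Rightarrow> real" where
  "g_form Lx \<tau> = 1 / \<tau>"
| "g_form Ly \<tau> = 1 / (1 - \<tau>)"

definition Delta :: "xy ptree \<Rightarrow> (nat list \<Rightarrow> real) set" where
  "Delta t = {\<tau> \<in> verts t \<rightarrow>\<^sub>E {0..1}.
                \<forall>u\<in>verts t. \<forall>v\<in>verts t. strict_prefix u v \<longrightarrow> \<tau> u > \<tau> v}"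

definition zeta_sh_T_tree :: "xy ptree \<Rightarrow> real" where
  "zeta_sh_T_tree t =
     (LINT \<tau>:Delta t|(\<Pi>\<^sub>M v\<in>verts t. lborel). \<Prod>v\<in>verts t. g_form (dec t v) (\<tau> v))"

definition zeta_sh_T :: "xy ptree lc \<Rightarrow> real" where
  "zeta_sh_T = lin_val zeta_sh_T_tree"


section \<open>Binarisation\<close>

fun sPN_tree :: "nat ptree \<Rightarrow> xy ptree" where
  "sPN_tree (Node n ts) = ((\<lambda>t. Node Lx [t]) ^^ (n - 1)) (Node Ly (map sPN_tree ts))"

definition sPN :: "nat ptree lc \<Rightarrow> xy ptree lc" where
  "sPN = lin_ext (\<lambda>t. bvec (sPN_tree t))"

text \<open>
  \<open>stem ns n F\<close> is the tree \<open>B(F)\<close> for \<open>B = B\<^sub>+\<^bsup>n\<^sub>1\<^esup> \<circ> \<dots> \<circ> B\<^sub>+\<^bsup>n\<^sub>p\<^esup>\<close> with \<open>ns = [n\<^sub>1, \<dots>, n\<^bsub>p-1\<^esub>]\<close> and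
  \<open>n = n\<^sub>p\<close>; separating the last decoration makes \<open>p \<ge> 1\<close> automatic. \<open>decomp\<close> recovers \<open>B\<close>
  and \<open>F\<close>, see the lemmas \<open>stem_decomp\<close>, \<open>decomp_stem\<close> and \<open>non_ladder_decomp\<close>.
\<close>

definition stem :: "'a list \<Rightarrow> 'a \<Rightarrow> 'a ptree list \<Rightarrow> 'a ptree" where
  "stem ns n F = foldr (\<lambda>m t. Node m [t]) ns (Node n F)"

fun decomp :: "'a ptree \<Rightarrow> 'a list \<times> 'a \<times> 'a ptree list" where
  "decomp (Node n [t]) = (case decomp t of (ns, m, F) \<Rightarrow> (n # ns, m, F))"
| "decomp (Node n F) = ([], n, F)"

lemma stem_decomp: "decomp T = (ns, n, F) \<Longrightarrow> stem ns n F = T"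
  by (induction T arbitrary: ns n F rule: decomp.induct)
     (auto simp: stem_def split: prod.splits)

lemma decomp_stem: "length F \<noteq> 1 \<Longrightarrow> decomp (stem ns n F) = (ns, n, F)"
proof (induction ns)
  case Nil
  then show ?case
    by (cases F rule: remdups_adj.cases) (auto simp: stem_def)
next
  case (Cons m ns)
  then show ?case by (simp add: stem_def)
qed

lemma ladder_Node: "ladder (Node n ts) \<longleftrightarrow> length ts \<le> 1 \<and> (\<forall>t\<in>set ts. ladder t)"
  unfolding ladder_def by (auto simp: all_set_conv_all_nth)

lemma non_ladder_decomp:
  assumes "\<not> ladder T"
  obtains ns n na Fa nb Fb F
  where "decomp T = (ns, n, Node na Fa # Node nb Fb # F)"
    and "T = stem ns n (Node na Fa # Node nb Fb # F)"
proof -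
  have "\<exists>ns n na Fa nb Fb F. decomp T = (ns, n, Node na Fa # Node nb Fb # F)"
    using assms
  proof (induction T rule: decomp.induct)
    case (1 n t)
    then show ?case by (fastforce simp: ladder_Node)
  next
    case ("2_1" n)
    then show ?case by (simp add: ladder_Node)
  next
    case ("2_2" n a b F)
    then show ?case by (cases a; cases b) auto
  qed
  then show thesis using that by (metis stem_decomp)
qed

text \<open>
  For a ladder tree, \<open>decomp\<close> returns an empty forest, so it falls under the default case of
  the definitions below (in particular \<open>err T = 0\<close>).
  \<open>T_sum\<close>, \<open>T_up_ab\<close> and \<open>T_up_ba\<close> are \<open>T\<^bsub>a+b\<^esub>\<close>, \<open>T\<^sup>a\<^sub>b\<close> and \<open>T\<^sup>b\<^sub>a\<close>; their values on ladder trees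
  are irrelevant.
\<close>

definition T_sum :: "nat ptree \<Rightarrow> nat ptree" where
  "T_sum T = (case decomp T of
     (ns, n, Node na Fa # Node nb Fb # F) \<Rightarrow> stem ns n (Node (na + nb) (Fa @ Fb) # F)
   | _ \<Rightarrow> T)"

definition T_up_ab :: "nat ptree \<Rightarrow> nat ptree" where
  "T_up_ab T = (case decomp T of
     (ns, n, Node na Fa # Node nb Fb # F) \<Rightarrow> stem ns n (Node na (Node nb Fb # Fa) # F)
   | _ \<Rightarrow> T)"

definition T_up_ba :: "nat ptree \<Rightarrow> nat ptree" where
  "T_up_ba T = (case decomp T of
     (ns, n, Node na Fa # Node nb Fb # F) \<Rightarrow> stem ns n (Node nb (Node na Fa # Fb) # F)
   | _ \<Rightarrow> T)"

text \<open>
  Termination measure for the process tree: with \<open>P\<close> the product of the measures over a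
  forest, \<open>(1 + P F\<^sub>a) * (1 + P F\<^sub>b)\<close> exceeds \<open>1 + P F\<^sub>a * P F\<^sub>b\<close>, \<open>1 + (1 + P F\<^sub>b) * P F\<^sub>a\<close> and
  \<open>1 + (1 + P F\<^sub>a) * P F\<^sub>b\<close>.
\<close>

fun pr_measure :: "'a ptree \<Rightarrow> nat" where
  "pr_measure (Node a ts) = 1 + prod_list (map pr_measure ts)"

lemma pr_measure_pos: "pr_measure t > 0"
  by (cases t) simp

lemma prod_pr_measure_pos: "prod_list (map pr_measure ts) > 0"
  by (induction ts) (auto simp: pr_measure_pos)

lemma pr_measure_stem:
  "pr_measure (stem ns n F) < pr_measure (stem ns n G) \<longleftrightarrow>
   prod_list (map pr_measure F) < prod_list (map pr_measure G)"
  by (induction ns) (auto simp: stem_def)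

lemma pr_measure_decreasing:
  assumes "\<not> ladder T"
  shows "pr_measure (T_sum T) < pr_measure T"
    and "pr_measure (T_up_ab T) < pr_measure T"
    and "pr_measure (T_up_ba T) < pr_measure T"
proof -
  from assms obtain ns n na Fa nb Fb F
    where d: "decomp T = (ns, n, Node na Fa # Node nb Fb # F)"
      and T: "T = stem ns n (Node na Fa # Node nb Fb # F)"
    by (rule non_ladder_decomp)
  define pa pb p where "pa = prod_list (map pr_measure Fa)"
    and "pb = prod_list (map pr_measure Fb)" and "p = prod_list (map pr_measure F)"
  have pos: "pa > 0" "pb > 0" "p > 0"
    by (simp_all add: pa_def pb_def p_def prod_pr_measure_pos)
  have eq: "T_sum T = stem ns n (Node (na + nb) (Fa @ Fb) # F)"
    "T_up_ab T = stem ns n (Node na (Node nb Fb # Fa) # F)"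
    "T_up_ba T = stem ns n (Node nb (Node na Fa # Fb) # F)"
    by (simp_all add: T_sum_def T_up_ab_def T_up_ba_def d)
  have "(1 + pa * pb) * p < (1 + pa) * ((1 + pb) * p)"
    "(1 + (1 + pb) * pa) * p < (1 + pa) * ((1 + pb) * p)"
    "(1 + (1 + pa) * pb) * p < (1 + pa) * ((1 + pb) * p)"
    using pos by (simp_all add: algebra_simps)
  then show "pr_measure (T_sum T) < pr_measure T"
    and "pr_measure (T_up_ab T) < pr_measure T"
    and "pr_measure (T_up_ba T) < pr_measure T"
    unfolding eq unfolding T pr_measure_stem
    by (simp_all add: pa_def pb_def p_def)
qed

function pr :: "nat ptree \<Rightarrow> nat ptree ptree" where
  "pr T = (if ladder T then Node T []
           else Node T [pr (T_sum T), pr (T_up_ab T), pr (T_up_ba T)])"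
  by auto
termination
  by (relation "Wellfounded.measure pr_measure") (auto simp: pr_measure_decreasing)

declare pr.simps [simp del]

definition err :: "nat ptree \<Rightarrow> nat ptree lc" where
  "err T = (case decomp T of
     (ns, n, Node na Fa # Node nb Fb # F) \<Rightarrow>
       bvec (T_sum T)
       - (\<Sum>i = 1..na - 1. scale (real ((na - i + nb - 1) choose (nb - 1)))
            (bvec (stem ns n (Node (na + nb - i) (Node i Fa # Fb) # F))))
       - (\<Sum>i = 1..nb - 1. scale (real ((nb - i + na - 1) choose (na - 1)))
            (bvec (stem ns n (Node (na + nb - i) (Node i Fb # Fa) # F))))
   | _ \<Rightarrow> 0)"

definition phi_tree :: "nat ptree \<Rightarrow> nat ptree lc" where
  "phi_tree T = bvec T + (\<Sum>v\<in>verts (pr T). err (dec (pr T) v))"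

definition phi :: "nat ptree lc \<Rightarrow> nat ptree lc" where
  "phi = lin_ext phi_tree"

definition sPT :: "nat ptree lc \<Rightarrow> xy ptree lc" where
  "sPT = sPN \<circ> phi"

end

theory Submission
  imports Defs
begin

text \<open>
  Commutativity of the square is proved along the process tree. Splitting the product of the first two
  branches \<open>n\<^sub>a F\<^sub>a\<close> and \<open>n\<^sub>b F\<^sub>b\<close> above the stem by the recursion of the quasi-shuffle gives the three trees
  \<open>T\<^bsub>a+b\<^esub>\<close>, \<open>T\<^sup>a\<^sub>b\<close>, \<open>T\<^sup>b\<^sub>a\<close>; on the binarised side the shuffle of \<open>x\<^bsup>n\<^sub>a-1\<^esup>y u\<close> and \<open>x\<^bsup>n\<^sub>b-1\<^esup>y v\<close>, sorted by the
  position of the first \<open>y\<close>, gives \<open>T\<^sup>a\<^sub>b\<close>, \<open>T\<^sup>b\<^sub>a\<close> and exactly the trees subtracted in \<open>T\<^sup>e\<close>. Hence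
  \<open>T + T\<^sup>e\<close> and the sum of the three trees have the same binarised flattening, and the claim follows by
  induction on \<open>pr(T)\<close>.

  For the zeta values, both the series and the integral are instances of one nested integral against a
  sigma-finite measure on a linear order, with values in \<open>[0, \<infinity>]\<close> so that no convergence question arises.
  By Fubini the value of a tree is the value of its flattening: splitting a product
  of two integrals according to the order of the outermost variables gives the two shuffle terms and a diagonal
  term weighted by the measure of points, which vanishes for Lebesgue measure and is the contraction term
  for counting measure. Along the words \<open>x\<^bsup>n-1\<^esup>y\<close> the nested integrals over \<open>[0, t]\<close> are power series in \<open>t\<close>, and
  at \<open>t = 1\<close> they are the nested sums. Finiteness is needed only at the end, for words, to pass to
  linear combinations with negative coefficients.
\<close>

section \<open>Linear maps on free vector spaces\<close>

definition lin :: "('a lc \<Rightarrow> 'b lc) \<Rightarrow> bool" where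
  "lin f \<longleftrightarrow> (\<forall>p q. f (p + q) = f p + f q) \<and> (\<forall>c p. f (scale c p) = scale c (f p))"

lemma scale_add_right: "scale c (p + q) = scale c p + scale c q"
  and scale_add_left: "scale (c + d) p = scale c p + scale d p"
  and scale_scale: "scale c (scale d p) = scale (c * d) p"
  and scale_zero_left: "scale 0 p = 0"
  and scale_zero_right: "scale c 0 = 0"
  by (rule poly_mapping_eqI; simp add: lookup_add algebra_simps)+

lemma scale_sum: "scale c (sum f A) = (\<Sum>a\<in>A. scale c (f a))"
  by (induction A rule: infinite_finite_induct) (simp_all add: scale_add_right scale_zero_right)

lemma lin_add: "lin f \<Longrightarrow> f (p + q) = f p + f q"
  and lin_scale: "lin f \<Longrightarrow> f (scale c p) = scale c (f p)"
  by (simp_all add: lin_def)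

lemma lin_zero: "lin f \<Longrightarrow> f 0 = 0"
  using lin_scale[of f 0 0] by (simp add: scale_zero_left)

lemma lin_diff: "lin f \<Longrightarrow> f (p - q) = f p - f q"
  using lin_add[of f "p - q" q] by simp

lemma lin_sum: "lin f \<Longrightarrow> f (sum g A) = (\<Sum>a\<in>A. f (g a))"
  by (induction A rule: infinite_finite_induct) (simp_all add: lin_zero lin_add)

lemma lin_id: "lin (\<lambda>p. p)"
  by (simp add: lin_def)

lemma lin_comp: "lin f \<Longrightarrow> lin g \<Longrightarrow> lin (\<lambda>p. f (g p))"
  by (simp add: lin_def)

lemma lin_plus: "lin f \<Longrightarrow> lin g \<Longrightarrow> lin (\<lambda>p. f p + g p)"
  by (simp add: lin_def scale_add_right add_ac)

lemma lin_scaled: "lin f \<Longrightarrow> lin (\<lambda>p. scale c (f p))"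
  by (simp add: lin_def scale_add_right scale_scale mult.commute)

lemma lin_sum_fun: "(\<And>a. a \<in> A \<Longrightarrow> lin (f a)) \<Longrightarrow> lin (\<lambda>p. \<Sum>a\<in>A. f a p)"
  by (induction A rule: infinite_finite_induct) (simp_all add: lin_def scale_zero_right scale_add_right add_ac)

lemma lin_funpow: "lin (f :: 'a lc \<Rightarrow> 'a lc) \<Longrightarrow> lin (f ^^ n)"
  by (induction n) (simp_all add: lin_def)

lemma lc_expand: "p = (\<Sum>b\<in>Poly_Mapping.keys p. scale (Poly_Mapping.lookup p b) (bvec b))"
proof (rule poly_mapping_eqI)
  fix b
  show "Poly_Mapping.lookup p b = Poly_Mapping.lookup (\<Sum>b\<in>Poly_Mapping.keys p. scale (Poly_Mapping.lookup p b) (bvec b)) b"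
    by (auto simp: lookup_sum lookup_single when_def in_keys_iff if_distrib sum.delta cong: if_cong)
qed

text \<open>Only basis vectors in the support of \<open>p\<close> are compared, so that membership
  of \<open>p\<close> in a convergent subspace can be used for each of them.\<close>

lemma lin_eqI:
  assumes "lin f" "lin g" "\<And>b. b \<in> Poly_Mapping.keys p \<Longrightarrow> f (bvec b) = g (bvec b)"
  shows "f p = g p"
proof -
  have "h p = (\<Sum>b\<in>Poly_Mapping.keys p. scale (Poly_Mapping.lookup p b) (h (bvec b)))" if "lin h" for h :: "'a lc \<Rightarrow> 'b lc"
    using arg_cong[OF lc_expand[of p], of h] that by (simp only: lin_sum lin_scale)
  from this[OF assms(1)] this[OF assms(2)] show ?thesis
    by (simp only: assms(3) cong: sum.cong)
qed

lemma lookup_lin_ext: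
  "Poly_Mapping.lookup (lin_ext f p) b =
     (\<Sum>a\<in>Poly_Mapping.keys p. Poly_Mapping.lookup p a * Poly_Mapping.lookup (f a) b)"
  by (simp add: lin_ext_def lookup_sum)

text \<open>Padding with zero coefficients lets combinations with different supports be summed over
  one finite set.\<close>

lemma lin_ext_superset:
  assumes "finite A" "Poly_Mapping.keys p \<subseteq> A"
  shows "lin_ext f p = (\<Sum>b\<in>A. scale (Poly_Mapping.lookup p b) (f b))"
  unfolding lin_ext_def using assms
  by (intro sum.mono_neutral_left) (auto simp: in_keys_iff scale_zero_left)

lemma lin_lin_ext: "lin (lin_ext f)"
  unfolding lin_def
proof (intro conjI allI)
  fix p q :: "'a lc" and c :: real
  let ?A = "Poly_Mapping.keys p \<union> Poly_Mapping.keys q"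
  have "lin_ext f (p + q) = (\<Sum>b\<in>?A. scale (Poly_Mapping.lookup (p + q) b) (f b))"
    by (rule lin_ext_superset) (simp_all add: Poly_Mapping.keys_add)
  moreover have "lin_ext f p = (\<Sum>b\<in>?A. scale (Poly_Mapping.lookup p b) (f b))"
    "lin_ext f q = (\<Sum>b\<in>?A. scale (Poly_Mapping.lookup q b) (f b))"
    by (rule lin_ext_superset; auto)+
  ultimately show "lin_ext f (p + q) = lin_ext f p + lin_ext f q"
    by (simp add: lookup_add scale_add_left sum.distrib)
  have "lin_ext f (scale c p) = (\<Sum>b\<in>Poly_Mapping.keys p. scale (Poly_Mapping.lookup (scale c p) b) (f b))"
    by (rule lin_ext_superset) (auto simp: in_keys_iff)
  then show "lin_ext f (scale c p) = scale c (lin_ext f p)"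
    by (simp add: lin_ext_def scale_sum scale_scale)
qed

lemma lin_prepend: "lin (prepend a)"
  by (simp add: prepend_def lin_lin_ext)

lemma prepend_bvec [simp]: "prepend a (bvec w) = bvec (a # w)"
  by (simp add: prepend_def)

lemma lin_bilin_left: "lin (\<lambda>p. bilin_ext f p q)"
  by (simp add: bilin_ext_def lin_lin_ext)

lemma lin_bilin_right: "lin (bilin_ext f p)"
proof -
  have "lin (\<lambda>q. \<Sum>a\<in>Poly_Mapping.keys p. scale (Poly_Mapping.lookup p a) (lin_ext (f a) q))"
    by (rule lin_sum_fun) (rule lin_scaled[OF lin_lin_ext])
  then show ?thesis
    by (simp add: bilin_ext_def[abs_def] lin_ext_def[of _ p])
qed

lemma bilin_bvec [simp]: "bilin_ext f (bvec a) (bvec b) = f a b"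
  by (simp add: bilin_ext_def)

lemma lin_val_superset:
  assumes "finite A" "Poly_Mapping.keys p \<subseteq> A"
  shows "lin_val f p = (\<Sum>b\<in>A. Poly_Mapping.lookup p b * f b)"
  unfolding lin_val_def using assms
  by (intro sum.mono_neutral_left) (auto simp: in_keys_iff)

text \<open>Two finite sums are exchanged after extending the inner ones to a set \<open>?A\<close>
  that covers every support involved. This carries values of trees through \<open>flat1\<close>,
  \<open>s_map\<close> and \<open>flat0\<close>.\<close>

lemma lin_val_lin_ext: "lin_val f (lin_ext g p) = lin_val (\<lambda>b. lin_val f (g b)) p"
proof -
  let ?A = "Poly_Mapping.keys (lin_ext g p) \<union> (\<Union>b\<in>Poly_Mapping.keys p. Poly_Mapping.keys (g b))"
  have "lin_val f (lin_ext g p) = (\<Sum>c\<in>?A. Poly_Mapping.lookup (lin_ext g p) c * f c)"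
    by (rule lin_val_superset) auto
  also have "\<dots> = (\<Sum>b\<in>Poly_Mapping.keys p. Poly_Mapping.lookup p b * (\<Sum>c\<in>?A. Poly_Mapping.lookup (g b) c * f c))"
    unfolding lookup_lin_ext sum_distrib_left sum_distrib_right
    by (subst sum.swap) (simp add: mult_ac)
  also have "\<dots> = lin_val (\<lambda>b. lin_val f (g b)) p"
    unfolding lin_val_def[of _ p]
    by (intro sum.cong refl arg_cong2[where f = "(*)"] lin_val_superset[symmetric]) auto
  finally show ?thesis .
qed

lemma lin_val_cong: "(\<And>b. b \<in> Poly_Mapping.keys p \<Longrightarrow> f b = g b) \<Longrightarrow> lin_val f p = lin_val g p"
  by (simp add: lin_val_def)

section \<open>Shuffle and quasi-shuffle products\<close>

text \<open>The contraction coefficient \<open>e\<close> covers both products: \<open>e = 0\<close>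
  gives \<open>sh\<close>, and \<open>e = 1\<close> with addition of letters gives
  \<open>qsh\<close>. Commutativity and associativity are thus proved once.\<close>

locale quasi_shuffle =
  fixes m :: "'a \<Rightarrow> 'a \<Rightarrow> 'a" and e :: real
  assumes m_commute: "m a b = m b a" and m_assoc: "m (m a b) c = m a (m b c)"
begin

fun qs_word :: "'a list \<Rightarrow> 'a list \<Rightarrow> 'a list lc" where
  "qs_word [] v = bvec v"
| "qs_word u [] = bvec u"
| "qs_word (a # u) (b # v) =
     prepend a (qs_word u (b # v)) + prepend b (qs_word (a # u) v)
     + scale e (prepend (m a b) (qs_word u v))"

lemma qs_word_Nil_right [simp]: "qs_word u [] = bvec u"
  by (cases u) simp_all

definition qs :: "'a list lc \<Rightarrow> 'a list lc \<Rightarrow> 'a list lc" (infixl "\<odot>" 70) where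
  "qs = bilin_ext qs_word"

lemma qs_bvec [simp]: "bvec u \<odot> bvec v = qs_word u v"
  by (simp add: qs_def)

lemma lin_qs_left: "lin f \<Longrightarrow> lin (\<lambda>p. f p \<odot> q)"
  unfolding qs_def by (rule lin_comp[OF lin_bilin_left])

lemma lin_qs_right: "lin f \<Longrightarrow> lin (\<lambda>p. q \<odot> f p)"
  unfolding qs_def by (rule lin_comp[OF lin_bilin_right])

lemmas lin_rules = lin_qs_left lin_qs_right lin_plus lin_scaled lin_id lin_comp[OF lin_prepend]

lemmas qs_add = lin_add[OF lin_qs_left[OF lin_id]] lin_add[OF lin_qs_right[OF lin_id]]
lemmas qs_scale = lin_scale[OF lin_qs_left[OF lin_id]] lin_scale[OF lin_qs_right[OF lin_id]]

lemma qs_one_left [simp]: "bvec [] \<odot> p = p"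
  by (rule lin_eqI[where f = "\<lambda>p. bvec [] \<odot> p" and g = "\<lambda>p. p"]; (intro lin_rules)?; simp)

lemma qs_one_right [simp]: "p \<odot> bvec [] = p"
  by (rule lin_eqI[where f = "\<lambda>p. p \<odot> bvec []" and g = "\<lambda>p. p"]; (intro lin_rules)?; simp)

lemma qs_word_commute: "qs_word u v = qs_word v u"
  by (induction u v rule: qs_word.induct) (simp_all add: m_commute add_ac)

lemma qs_commute: "p \<odot> q = q \<odot> p"
proof (rule lin_eqI[of "\<lambda>p. p \<odot> q"])
  fix u
  show "bvec u \<odot> q = q \<odot> bvec u"
    by (rule lin_eqI[of "\<lambda>q. bvec u \<odot> q"]; (intro lin_rules)?; simp add: qs_word_commute)
qed (intro lin_rules)+

lemma qs_prepend:
  "prepend a p \<odot> prepend b q =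
     prepend a (p \<odot> prepend b q) + prepend b (prepend a p \<odot> q) + scale e (prepend (m a b) (p \<odot> q))"
proof (rule lin_eqI[of "\<lambda>p. prepend a p \<odot> prepend b q"])
  fix u
  show "prepend a (bvec u) \<odot> prepend b q = prepend a (bvec u \<odot> prepend b q)
      + prepend b (prepend a (bvec u) \<odot> q) + scale e (prepend (m a b) (bvec u \<odot> q))"
    by (rule lin_eqI[of "\<lambda>q. prepend a (bvec u) \<odot> prepend b q"]; (intro lin_rules)?; simp)
qed (intro lin_rules)+

lemmas lin_simps = qs_add qs_scale lin_add[OF lin_prepend] lin_scale[OF lin_prepend]
  scale_add_right scale_scale

text \<open>Both bracketings expand into seven terms, one for each nonempty subset of the three
  first letters that is merged into the leading letter. The tails have smaller total length, so the
  induction hypothesis rebrackets them.\<close>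

lemma qs_word_assoc: "qs_word u v \<odot> bvec w = bvec u \<odot> qs_word v w"
proof (induction "length u + length v + length w" arbitrary: u v w rule: less_induct)
  case less
  show ?case
  proof (cases "u = [] \<or> v = [] \<or> w = []")
    case True
    then show ?thesis by auto
  next
    case False
    then obtain a u' b v' c w' where [simp]: "u = a # u'" "v = b # v'" "w = c # w'"
      by (metis neq_Nil_conv)
    let ?U = "prepend a (bvec u')" and ?V = "prepend b (bvec v')" and ?W = "prepend c (bvec w')"
    have IH: "(bvec x \<odot> bvec y) \<odot> bvec z = bvec x \<odot> (bvec y \<odot> bvec z)"
      if "length x + length y + length z < length u + length v + length w" for x y z
      using less(1)[OF that] by simp
    have "(?U \<odot> ?V) \<odot> ?W = ?U \<odot> (?V \<odot> ?W)"
    proof -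
      \<comment> \<open>Each of the three terms of \<open>?U \<odot> ?V\<close> produces a summand
        starting with \<open>c\<close>; these reassemble into \<open>prepend c\<close> of the full
        product \<open>?U \<odot> ?V\<close> times the tail.\<close>
      have l: "(?U \<odot> ?V) \<odot> ?W =
          prepend a ((bvec u' \<odot> ?V) \<odot> ?W) + prepend b ((?U \<odot> bvec v') \<odot> ?W)
        + prepend c ((?U \<odot> ?V) \<odot> bvec w')
        + scale e (prepend (m a b) ((bvec u' \<odot> bvec v') \<odot> ?W))
        + scale e (prepend (m a c) ((bvec u' \<odot> ?V) \<odot> bvec w'))
        + scale e (prepend (m b c) ((?U \<odot> bvec v') \<odot> bvec w'))
        + scale (e * e) (prepend (m (m a b) c) ((bvec u' \<odot> bvec v') \<odot> bvec w'))"
        by (simp only: qs_prepend[of a "bvec u'" b "bvec v'"] lin_simps qs_prepend[of _ _ c])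
           (simp only: add_ac)
      have r: "?U \<odot> (?V \<odot> ?W) =
          prepend a (bvec u' \<odot> (?V \<odot> ?W)) + prepend b (?U \<odot> (bvec v' \<odot> ?W))
        + prepend c (?U \<odot> (?V \<odot> bvec w'))
        + scale e (prepend (m a b) (bvec u' \<odot> (bvec v' \<odot> ?W)))
        + scale e (prepend (m a c) (bvec u' \<odot> (?V \<odot> bvec w')))
        + scale e (prepend (m b c) (?U \<odot> (bvec v' \<odot> bvec w')))
        + scale (e * e) (prepend (m a (m b c)) (bvec u' \<odot> (bvec v' \<odot> bvec w')))"
        by (simp only: qs_prepend[of b "bvec v'" c "bvec w'"] lin_simps qs_prepend[of a])
           (simp only: add_ac)
      show ?thesis
        unfolding l r unfolding m_assoc prepend_bvec by (simp add: IH del: qs_bvec)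
    qed
    then show ?thesis by simp
  qed
qed

lemma qs_assoc: "(p \<odot> q) \<odot> r = p \<odot> (q \<odot> r)"
proof (rule lin_eqI[of "\<lambda>p. (p \<odot> q) \<odot> r"])
  fix u
  show "(bvec u \<odot> q) \<odot> r = bvec u \<odot> (q \<odot> r)"
  proof (rule lin_eqI[of "\<lambda>q. (bvec u \<odot> q) \<odot> r"])
    fix v
    show "(bvec u \<odot> bvec v) \<odot> r = bvec u \<odot> (bvec v \<odot> r)"
      by (rule lin_eqI[of "\<lambda>r. (bvec u \<odot> bvec v) \<odot> r"]; (intro lin_rules)?; simp add: qs_word_assoc)
  qed (intro lin_rules)+
qed (intro lin_rules)+

lemma foldr_qs_append:
  "foldr (\<odot>) (ps @ ps') (bvec []) = foldr (\<odot>) ps (bvec []) \<odot> foldr (\<odot>) ps' (bvec [])"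
  by (induction ps) (simp_all add: qs_assoc)

end

text \<open>With coefficient \<open>0\<close> the contraction is irrelevant; any associative commutative operation does.\<close>

interpretation shuffle: quasi_shuffle "\<lambda>_ _. Lx" 0
  rewrites "quasi_shuffle.qs (\<lambda>_ _. Lx) 0 = sh"
proof -
  interpret quasi_shuffle "\<lambda>_ _. Lx" 0
    by standard simp_all
  show "quasi_shuffle (\<lambda>_ _. Lx)" ..
  have "qs_word u v = sh_word u v" for u v
    by (induction u v rule: qs_word.induct) (simp_all add: scale_zero_left)
  then have "qs_word = sh_word" by blast
  then show "qs = sh"
    by (simp add: qs_def sh_def)
qed

interpretation quasi: quasi_shuffle "(+) :: nat \<Rightarrow> nat \<Rightarrow> nat" 1
  rewrites "quasi_shuffle.qs ((+) :: nat \<Rightarrow> nat \<Rightarrow> nat) 1 = qsh"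
proof -
  interpret quasi_shuffle "(+) :: nat \<Rightarrow> nat \<Rightarrow> nat" 1
    by standard simp_all
  show "quasi_shuffle ((+) :: nat \<Rightarrow> nat \<Rightarrow> nat)" ..
  have "qs_word u v = qsh_word u v" for u v
    by (induction u v rule: qs_word.induct) simp_all
  then have "qs_word = qsh_word" by blast
  then show "qs = qsh"
    by (simp add: qs_def qsh_def)
qed

section \<open>The commuting square\<close>

lemma finite_verts [simp]: "finite (verts t)"
  by (induction t rule: verts.induct) simp

text \<open>Stated for any commutative monoid so that sums over process trees and products of
  integrands unfold by the same rule.\<close>

lemma (in comm_monoid_set) verts_Node:
  "F g (verts (Node a ts)) = g [] \<^bold>* F (\<lambda>i. F (\<lambda>v. g (i # v)) (verts (ts ! i))) {..<length ts}"
proof -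
  have "F g (\<Union>i\<in>{..<length ts}. (#) i ` verts (ts ! i))
      = F (\<lambda>i. F g ((#) i ` verts (ts ! i))) {..<length ts}"
    by (rule UNION_disjoint) auto
  also have "\<dots> = F (\<lambda>i. F (\<lambda>v. g (i # v)) (verts (ts ! i))) {..<length ts}"
    by (simp add: reindex o_def)
  finally show ?thesis
    by (simp add: insert image_iff)
qed

lemma dec_Nil [simp]: "dec (Node a ts) [] = a"
  and dec_Cons [simp]: "dec (Node a ts) (i # v) = dec (ts ! i) v"
  by (simp_all add: dec_def)

text \<open>Conditions on all decorations can now be expressed by \<open>set_ptree\<close>, which
  follows the structure of the tree without addresses.\<close>

lemma dec_image_verts: "dec t ` verts t = set_ptree t"
proof (induction t)
  case (Node a ts)
  have "dec (Node a ts) ` verts (Node a ts) = insert a (\<Union>i<length ts. dec (ts ! i) ` verts (ts ! i))"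
    by (auto simp: image_UN image_image)
  also have "\<dots> = insert a (\<Union>i<length ts. set_ptree (ts ! i))"
    using Node.IH by auto
  also have "\<dots> = set_ptree (Node a ts)"
    by (force simp: in_set_conv_nth)
  finally show ?case .
qed

lemma ball_dec_verts: "(\<forall>v\<in>verts t. P (dec t v)) \<longleftrightarrow> (\<forall>d\<in>set_ptree t. P d)"
  by (simp flip: dec_image_verts)

lemma stem_Nil [simp]: "stem [] n F = Node n F"
  and stem_Cons [simp]: "stem (m # ns) n F = Node m [stem ns n F]"
  by (simp_all add: stem_def)

lemma set_ptree_stem: "set_ptree (stem ns n F) = set ns \<union> {n} \<union> (\<Union>t\<in>set F. set_ptree t)"
  by (induction ns) auto

lemma rootdec_stem: "rootdec (stem ns n F) = hd (ns @ [n])"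
  by (cases ns) auto

lemma decomp_ladder: "ladder T \<Longrightarrow> \<exists>ns n. decomp T = (ns, n, [])"
  by (induction T rule: decomp.induct) (auto simp: ladder_Node)

text \<open>
  The part of the shuffle of \<open>x\<^sup>m y u\<close> and \<open>x\<^sup>n y v\<close> in which the first \<open>y\<close> comes from the second word:
  it is then preceded by the \<open>n\<close> letters of that word and by \<open>j\<close> of the \<open>m\<close> letters of the first.
\<close>

definition shuffle_sum :: "nat \<Rightarrow> nat \<Rightarrow> (nat \<Rightarrow> xy list lc) \<Rightarrow> xy list lc" where
  "shuffle_sum m n f = (\<Sum>j\<le>m. scale (real ((j + n) choose n)) ((prepend Lx ^^ (j + n)) (f (m - j))))"

lemmas prepend_sum = lin_sum[OF lin_prepend]
lemmas prepend_scale = lin_scale[OF lin_prepend]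
lemmas prepend_add = lin_add[OF lin_prepend]

lemma shuffle_sum_0_left: "shuffle_sum 0 n f = (prepend Lx ^^ n) (f 0)"
  by (simp add: shuffle_sum_def)

lemma shuffle_sum_0_right: "shuffle_sum (Suc m) 0 f = f (Suc m) + prepend Lx (shuffle_sum m 0 f)"
  by (simp add: shuffle_sum_def sum.atMost_Suc_shift prepend_sum del: sum.atMost_Suc)

text \<open>Pascal's rule: the leading x comes either from the first word or from the
  second.\<close>

lemma shuffle_sum_Suc:
  "shuffle_sum (Suc m) (Suc n) f =
     prepend Lx (shuffle_sum m (Suc n) f) + prepend Lx (shuffle_sum (Suc m) n f)"
proof -
  have c: "real (Suc (Suc (j + n)) choose Suc n) = real (Suc (j + n) choose Suc n) + real (Suc (j + n) choose n)" for j
    by simp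
  show ?thesis
    unfolding shuffle_sum_def sum.atMost_Suc_shift[of _ m] add_Suc_right add_Suc add_0 diff_Suc_Suc c
      scale_add_left sum.distrib prepend_add prepend_sum prepend_scale
    by (simp add: add_ac)
qed

lemma sh_prepend:
  fixes p q :: "xy list lc"
  shows "sh (prepend a p) (prepend b q) = prepend a (sh p (prepend b q)) + prepend b (sh (prepend a p) q)"
  using shuffle.qs_prepend[of a p b q] by (simp add: scale_zero_left)

text \<open>Induction on the number of leading x's: the shuffle recursion removes one of them, and
  the results recombine by Pascal's rule. If a word has no leading x, the summand starting with its
  y is the term \<open>j = 0\<close> of the corresponding \<open>shuffle_sum\<close>.\<close>

lemma sh_depth:
  fixes u v :: "xy list lc"
  shows "sh ((prepend Lx ^^ m) (prepend Ly u)) ((prepend Lx ^^ n) (prepend Ly v)) =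
     shuffle_sum m n (\<lambda>i. prepend Ly (sh ((prepend Lx ^^ i) (prepend Ly u)) v))
   + shuffle_sum n m (\<lambda>i. prepend Ly (sh u ((prepend Lx ^^ i) (prepend Ly v))))"
    (is "?L m n = ?f m n + ?g n m")
proof (induction "m + n" arbitrary: m n rule: less_induct)
  case less
  show ?case
  proof (cases m; cases n)
    assume "m = 0" "n = 0"
    then show ?thesis
      by (simp add: shuffle_sum_0_left sh_prepend add.commute)
  next
    fix n' assume [simp]: "m = 0" "n = Suc n'"
    have "?L 0 n' = ?f 0 n' + ?g n' 0"
      by (rule less) simp
    then show ?thesis
      by (simp add: shuffle_sum_0_left shuffle_sum_0_right sh_prepend prepend_add add_ac)
  next
    fix m' assume [simp]: "m = Suc m'" "n = 0"
    have "?L m' 0 = ?f m' 0 + ?g 0 m'"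
      by (rule less) simp
    then show ?thesis
      by (simp add: shuffle_sum_0_left shuffle_sum_0_right sh_prepend prepend_add add_ac)
  next
    fix m' n' assume [simp]: "m = Suc m'" "n = Suc n'"
    have "?L m' n = ?f m' n + ?g n m'" "?L m n' = ?f m n' + ?g n' m"
      by (rule less; simp)+
    then have *: "?L m' (Suc n') = ?f m' (Suc n') + ?g (Suc n') m'"
      "?L (Suc m') n' = ?f (Suc m') n' + ?g n' (Suc m')"
      by simp_all
    have "?L m n = prepend Lx (?L m' (Suc n')) + prepend Lx (?L (Suc m') n')"
      by (simp add: sh_prepend)
    also have "\<dots> = ?f m n + ?g n m"
      by (simp add: * shuffle_sum_Suc prepend_add add_ac del: funpow.simps)
    finally show ?thesis .
  qed
qed

section \<open>Flattened forests and the splitting of the first two branches\<close>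

definition qsh_forest :: "nat ptree list \<Rightarrow> nat list lc" where
  "qsh_forest F = foldr qsh (map flat1_tree F) (bvec [])"

lemma qsh_forest_Nil [simp]: "qsh_forest [] = bvec []"
  and qsh_forest_Cons [simp]: "qsh_forest (T # F) = qsh (flat1_tree T) (qsh_forest F)"
  and qsh_forest_append: "qsh_forest (F @ G) = qsh (qsh_forest F) (qsh_forest G)"
  by (simp_all add: qsh_forest_def quasi.foldr_qs_append del: foldr_append)

lemma flat1_tree_Node: "flat1_tree (Node n F) = prepend n (qsh_forest F)"
  by (simp add: qsh_forest_def)

declare flat1_tree.simps [simp del]

text \<open>The truncated difference matches \<open>s_word\<close> and \<open>sPN_tree\<close>,
  which treat the value 0 like 1.\<close>

abbreviation block :: "nat \<Rightarrow> xy list lc \<Rightarrow> xy list lc" where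
  "block n p \<equiv> (prepend Lx ^^ (n - 1)) (prepend Ly p)"

definition flat_bin :: "nat ptree \<Rightarrow> xy list lc" where
  "flat_bin T = flat0_tree (sPN_tree T)"

definition sh_forest :: "nat ptree list \<Rightarrow> xy list lc" where
  "sh_forest F = foldr sh (map flat_bin F) (bvec [])"

lemma sh_forest_Nil [simp]: "sh_forest [] = bvec []"
  and sh_forest_Cons [simp]: "sh_forest (T # F) = sh (flat_bin T) (sh_forest F)"
  by (simp_all add: sh_forest_def)

lemma flat0_tree_funpow:
  "flat0_tree (((\<lambda>t. Node Lx [t]) ^^ k) t) = (prepend Lx ^^ k) (flat0_tree t)"
  by (induction k) simp_all

lemma flat_bin_Node: "flat_bin (Node n F) = block n (sh_forest F)"
  by (simp add: flat_bin_def[abs_def] sh_forest_def flat0_tree_funpow o_def)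

lemma lin_block: "lin (block n)"
  by (rule lin_comp[OF lin_funpow[OF lin_prepend] lin_prepend])

lemma s_map_prepend: "s_map (prepend n p) = block n (s_map p)"
proof (rule lin_eqI[of "\<lambda>p. s_map (prepend n p)" "\<lambda>p. block n (s_map p)"])
  show "lin (\<lambda>p. s_map (prepend n p))"
    unfolding s_map_def by (rule lin_comp[OF lin_lin_ext lin_prepend])
  show "lin (\<lambda>p. block n (s_map p))"
    unfolding s_map_def by (rule lin_comp[OF lin_block lin_lin_ext])
  fix w
  have "(prepend Lx ^^ k) (bvec v) = bvec (replicate k Lx @ v)" for k v
    by (induction k) simp_all
  then show "s_map (prepend n (bvec w)) = block n (s_map (bvec w))"
    by (simp add: s_map_def s_word_def)
qed

lemma flat1_stem: "flat1_tree (stem ns n F) = foldr prepend (ns @ [n]) (qsh_forest F)"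
  by (induction ns) (simp_all add: flat1_tree_Node)

lemma flat_bin_stem: "flat_bin (stem ns n F) = foldr block (ns @ [n]) (sh_forest F)"
  by (induction ns) (simp_all add: flat_bin_Node)

lemma lin_foldr_prepend: "lin (foldr prepend ns)"
proof (induction ns)
  case (Cons n ns)
  then show ?case using lin_comp[OF lin_prepend[of n] Cons] by (simp add: o_def)
qed (simp add: lin_def)

lemma lin_foldr_block: "lin (foldr block ns)"
proof (induction ns)
  case (Cons n ns)
  then show ?case using lin_comp[OF lin_block[of n] Cons] by (simp add: o_def)
qed (simp add: lin_def)

lemma qsh_prepend:
  "qsh (prepend a p) (prepend b q) =
     prepend a (qsh p (prepend b q)) + prepend b (qsh (prepend a p) q) + prepend (a + b) (qsh p q)"
  using quasi.qs_prepend[of a p b q] by simp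

text \<open>Associativity brings the first two branches together, and the recursion of
  \<open>qsh\<close> splits their product; \<open>r\<close> stands for the remaining branches.
  Commutativity puts the grafted branch in front, as in \<open>T_up_ab\<close>.\<close>

lemma qsh_prepend_triple:
  "qsh (prepend a p) (qsh (prepend b q) r) = qsh (prepend (a + b) (qsh p q)) r
     + qsh (prepend a (qsh (prepend b q) p)) r + qsh (prepend b (qsh (prepend a p) q)) r"
  by (simp only: quasi.qs_assoc[symmetric] qsh_prepend quasi.qs_add
      quasi.qs_commute[of p "prepend b q"] add_ac)

lemma flat1_split:
  assumes "\<not> ladder T"
  shows "flat1_tree T = flat1_tree (T_sum T) + flat1_tree (T_up_ab T) + flat1_tree (T_up_ba T)"
proof -
  from assms obtain ns n na Fa nb Fb F
    where d: "decomp T = (ns, n, Node na Fa # Node nb Fb # F)"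
      and T: "T = stem ns n (Node na Fa # Node nb Fb # F)"
    by (rule non_ladder_decomp)
  have eqs: "T_sum T = stem ns n (Node (na + nb) (Fa @ Fb) # F)"
    "T_up_ab T = stem ns n (Node na (Node nb Fb # Fa) # F)"
    "T_up_ba T = stem ns n (Node nb (Node na Fa # Fb) # F)"
    by (simp_all add: T_sum_def T_up_ab_def T_up_ba_def d)
  have "qsh_forest (Node na Fa # Node nb Fb # F) =
      qsh_forest (Node (na + nb) (Fa @ Fb) # F) + qsh_forest (Node na (Node nb Fb # Fa) # F)
      + qsh_forest (Node nb (Node na Fa # Fb) # F)"
    by (simp add: flat1_tree_Node qsh_forest_append qsh_prepend_triple)
  then show ?thesis
    unfolding eqs by (simp only: T flat1_stem lin_add[OF lin_foldr_prepend])
qed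

text \<open>Products over a ladder have at most one factor, so the two recursions run in parallel
  along a single chain.\<close>

lemma s_map_flat1_ladder: "ladder T \<Longrightarrow> flat_bin T = s_map (flat1_tree T)"
proof (induction T)
  case (Node n F)
  then have "F = [] \<or> (\<exists>t. F = [t] \<and> ladder t)"
    by (cases F) (auto simp: ladder_Node)
  then have "sh_forest F = s_map (qsh_forest F)"
    using Node.IH by (auto simp: s_map_def s_word_def)
  then show ?case
    by (simp add: flat_bin_Node flat1_tree_Node s_map_prepend)
qed

text \<open>Reindexing by \<open>i = a - j\<close>, so that \<open>i - 1\<close> letters x of the
  first word remain behind the first y. The term \<open>j = 0\<close> is split off because it
  corresponds to \<open>T_up_ab\<close> or \<open>T_up_ba\<close>; the others are the trees
  subtracted in \<open>err\<close>.\<close>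

lemma shuffle_sum_eq:
  assumes "1 \<le> a" "1 \<le> b"
  shows "shuffle_sum (a - 1) (b - 1) f = (prepend Lx ^^ (b - 1)) (f (a - 1))
     + (\<Sum>i = 1..a - 1. scale (real ((a - i + b - 1) choose (b - 1))) ((prepend Lx ^^ (a + b - i - 1)) (f (i - 1))))"
proof -
  let ?g = "\<lambda>j. scale (real ((j + (b - 1)) choose (b - 1))) ((prepend Lx ^^ (j + (b - 1))) (f (a - 1 - j)))"
  have "shuffle_sum (a - 1) (b - 1) f = ?g 0 + (\<Sum>j = 1..a - 1. ?g j)"
    unfolding shuffle_sum_def by (simp add: atMost_atLeast0 sum.atLeast_Suc_atMost)
  also have "(\<Sum>j = 1..a - 1. ?g j) = (\<Sum>i = 1..a - 1. ?g (a - i))"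
    using assms by (subst sum.atLeastAtMost_rev) simp
  also have "\<dots> = (\<Sum>i = 1..a - 1. scale (real ((a - i + b - 1) choose (b - 1))) ((prepend Lx ^^ (a + b - i - 1)) (f (i - 1))))"
  proof (intro sum.cong refl)
    fix i assume "i \<in> {1..a - 1}"
    then have "a - 1 - (a - i) = i - 1" "a - i + (b - 1) = a + b - i - 1" "a - i + b - 1 = a + b - i - 1"
      using assms by auto
    then show "?g (a - i) = scale (real ((a - i + b - 1) choose (b - 1))) ((prepend Lx ^^ (a + b - i - 1)) (f (i - 1)))"
      by simp
  qed
  finally show ?thesis by simp
qed

lemma sh_block:
  assumes "1 \<le> a" "1 \<le> b"
  shows "sh (block a p) (block b q) = block b (sh (block a p) q) + block a (sh (block b q) p)
     + (\<Sum>i = 1..a - 1. scale (real ((a - i + b - 1) choose (b - 1))) (block (a + b - i) (sh (block i p) q)))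
     + (\<Sum>i = 1..b - 1. scale (real ((b - i + a - 1) choose (a - 1))) (block (a + b - i) (sh (block i q) p)))"
  unfolding sh_depth shuffle_sum_eq[OF assms] shuffle_sum_eq[OF assms(2,1)]
  by (simp add: add_ac shuffle.qs_commute[of p])

lemma flat0_sPN_bvec: "flat0 (sPN (bvec T)) = flat_bin T"
  by (simp add: flat0_def sPN_def flat_bin_def)

lemma lin_flat0_sPN: "lin (\<lambda>p. flat0 (sPN p))"
  unfolding flat0_def sPN_def by (rule lin_comp[OF lin_lin_ext lin_lin_ext])

lemma flat_bin_split:
  assumes "\<not> ladder T" and pos: "\<forall>d\<in>set_ptree T. 1 \<le> d"
  shows "flat_bin T + flat0 (sPN (err T)) = flat_bin (T_sum T) + flat_bin (T_up_ab T) + flat_bin (T_up_ba T)"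
proof -
  from assms(1) obtain ns n na Fa nb Fb F
    where d: "decomp T = (ns, n, Node na Fa # Node nb Fb # F)"
      and T: "T = stem ns n (Node na Fa # Node nb Fb # F)"
    by (rule non_ladder_decomp)
  have p: "1 \<le> na" "1 \<le> nb"
    using pos by (auto simp: T set_ptree_stem)
  have eqs: "T_up_ab T = stem ns n (Node na (Node nb Fb # Fa) # F)"
    "T_up_ba T = stem ns n (Node nb (Node na Fa # Fb) # F)"
    by (simp_all add: T_up_ab_def T_up_ba_def d)
  let ?A = "\<lambda>i. stem ns n (Node (na + nb - i) (Node i Fa # Fb) # F)"
  let ?B = "\<lambda>i. stem ns n (Node (na + nb - i) (Node i Fb # Fa) # F)"
  let ?ca = "\<lambda>i. real ((na - i + nb - 1) choose (nb - 1))"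
  let ?cb = "\<lambda>i. real ((nb - i + na - 1) choose (na - 1))"
  have "sh_forest (Node na Fa # Node nb Fb # F) =
      sh_forest (Node nb (Node na Fa # Fb) # F) + sh_forest (Node na (Node nb Fb # Fa) # F)
      + (\<Sum>i = 1..na - 1. scale (?ca i) (sh_forest (Node (na + nb - i) (Node i Fa # Fb) # F)))
      + (\<Sum>i = 1..nb - 1. scale (?cb i) (sh_forest (Node (na + nb - i) (Node i Fb # Fa) # F)))"
  proof -
    have l: "lin (\<lambda>p. sh p (sh_forest F))"
      by (rule shuffle.lin_qs_left[OF lin_id])
    show ?thesis
      unfolding sh_forest_Cons flat_bin_Node shuffle.qs_assoc[symmetric] sh_block[OF p]
      by (simp only: lin_add[OF l] lin_sum[OF l] lin_scale[OF l])
  qed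
  then have "flat_bin T = flat_bin (T_up_ba T) + flat_bin (T_up_ab T)
      + (\<Sum>i = 1..na - 1. scale (?ca i) (flat_bin (?A i))) + (\<Sum>i = 1..nb - 1. scale (?cb i) (flat_bin (?B i)))"
    unfolding eqs by (simp only: T flat_bin_stem lin_add[OF lin_foldr_block] lin_sum[OF lin_foldr_block]
      lin_scale[OF lin_foldr_block])
  \<comment> \<open>\<open>err\<close> supplies the flattening of \<open>T_sum\<close> and cancels
    precisely the two correction sums of the preceding identity.\<close>
  moreover have "flat0 (sPN (err T)) = flat_bin (T_sum T)
      - (\<Sum>i = 1..na - 1. scale (?ca i) (flat_bin (?A i))) - (\<Sum>i = 1..nb - 1. scale (?cb i) (flat_bin (?B i)))"
    unfolding err_def d prod.case list.case ptree.case
    by (simp only: lin_diff[OF lin_flat0_sPN] lin_sum[OF lin_flat0_sPN] lin_scale[OF lin_flat0_sPN] flat0_sPN_bvec)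
  ultimately show ?thesis
    by simp
qed

section \<open>Recursion for \<open>phi_tree\<close> along the process tree\<close>

lemma phi_tree_ladder: "ladder T \<Longrightarrow> phi_tree T = bvec T"
  using decomp_ladder[of T] by (auto simp: phi_tree_def pr.simps err_def)

text \<open>For every \<open>U\<close>, the difference \<open>phi_tree U - bvec U\<close> is the sum
  of \<open>err\<close> over the process tree of \<open>U\<close>. Inductive arguments on
  \<open>phi_tree\<close> then need no sums over addresses.\<close>

lemma phi_tree_non_ladder:
  assumes "\<not> ladder T"
  shows "phi_tree T = bvec T + err T
    + (phi_tree (T_sum T) - bvec (T_sum T)) + (phi_tree (T_up_ab T) - bvec (T_up_ab T))
    + (phi_tree (T_up_ba T) - bvec (T_up_ba T))"
proof -
  have "pr T = Node T [pr (T_sum T), pr (T_up_ab T), pr (T_up_ba T)]"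
    using assms by (simp add: pr.simps)
  then show ?thesis
    by (simp add: phi_tree_def sum.verts_Node lessThan_Suc numeral_eq_Suc add_ac del: verts.simps)
qed

lemma set_ptree_T_sum_up:
  assumes "\<not> ladder T"
  shows "\<forall>d\<in>set_ptree T. 1 \<le> d \<Longrightarrow> \<forall>d\<in>set_ptree (T_sum T). 1 \<le> d"
    "set_ptree (T_up_ab T) = set_ptree T" "set_ptree (T_up_ba T) = set_ptree T"
proof -
  from assms(1) obtain ns n na Fa nb Fb F
    where d: "decomp T = (ns, n, Node na Fa # Node nb Fb # F)"
      and T: "T = stem ns n (Node na Fa # Node nb Fb # F)"
    by (rule non_ladder_decomp)
  have eqs: "T_sum T = stem ns n (Node (na + nb) (Fa @ Fb) # F)"
    "T_up_ab T = stem ns n (Node na (Node nb Fb # Fa) # F)"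
    "T_up_ba T = stem ns n (Node nb (Node na Fa # Fb) # F)"
    by (simp_all add: T_sum_def T_up_ab_def T_up_ba_def d)
  show "set_ptree (T_up_ab T) = set_ptree T" "set_ptree (T_up_ba T) = set_ptree T"
    unfolding eqs unfolding T set_ptree_stem by auto
  show "\<forall>d\<in>set_ptree (T_sum T). 1 \<le> d" if "\<forall>d\<in>set_ptree T. 1 \<le> d"
    using that unfolding eqs unfolding T set_ptree_stem by (auto simp: ball_Un)
qed

lemma flat0_sPN_phi_tree:
  "\<forall>d\<in>set_ptree T. 1 \<le> d \<Longrightarrow> flat0 (sPN (phi_tree T)) = s_map (flat1_tree T)"
proof (induction T rule: pr.induct)
  case (1 T)
  show ?case
  proof (cases "ladder T")
    case True
    then show ?thesis
      by (simp add: phi_tree_ladder flat0_sPN_bvec s_map_flat1_ladder)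
  next
    case False
    have IH: "flat0 (sPN (phi_tree U)) = s_map (flat1_tree U)" if "U \<in> {T_sum T, T_up_ab T, T_up_ba T}" for U
      using that 1 False set_ptree_T_sum_up[OF False] by auto
    have "lin s_map"
      unfolding s_map_def by (rule lin_lin_ext)
    then have "s_map (flat1_tree T) = s_map (flat1_tree (T_sum T)) + s_map (flat1_tree (T_up_ab T))
        + s_map (flat1_tree (T_up_ba T))"
      by (simp only: flat1_split[OF False] lin_add)
    \<comment> \<open>The induction hypothesis is inserted for the three children; their
      \<open>flat_bin\<close> terms then cancel against \<open>flat_bin T\<close> and the error by
      \<open>flat_bin_split\<close>.\<close>
    moreover have "flat0 (sPN (phi_tree T)) = flat_bin T + flat0 (sPN (err T))
      + (s_map (flat1_tree (T_sum T)) - flat_bin (T_sum T))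
      + (s_map (flat1_tree (T_up_ab T)) - flat_bin (T_up_ab T))
      + (s_map (flat1_tree (T_up_ba T)) - flat_bin (T_up_ba T))"
      by (simp add: phi_tree_non_ladder[OF False] lin_add[OF lin_flat0_sPN] lin_diff[OF lin_flat0_sPN]
          flat0_sPN_bvec IH)
    ultimately show ?thesis
      using flat_bin_split[OF False 1(4)] by (simp add: algebra_simps)
  qed
qed

section \<open>Convergent subspaces\<close>

lemma free_space_mono: "B \<subseteq> B' \<Longrightarrow> free_space K B \<subseteq> free_space K B'"
  by (auto simp: free_space_def)

section \<open>Leaves and roots of binarised trees\<close>

lemma leaves_Node:
  "leaves (Node a ts) = (if ts = [] then {[]} else \<Union>i<length ts. (#) i ` leaves (ts ! i))"
  by (auto simp: leaves_def)

lemma ball_leaves_Node: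
  "(\<forall>v\<in>leaves (Node a ts). P (dec (Node a ts) v)) \<longleftrightarrow>
     (if ts = [] then P a else \<forall>t\<in>set ts. \<forall>v\<in>leaves t. P (dec t v))"
  by (auto simp: leaves_Node all_set_conv_all_nth)

lemma leaves_sPN_tree: "\<forall>v\<in>leaves (sPN_tree t). dec (sPN_tree t) v = Ly"
proof (induction t)
  case (Node n ts)
  have "\<forall>v\<in>leaves (((\<lambda>t. Node Lx [t]) ^^ k) t). dec (((\<lambda>t. Node Lx [t]) ^^ k) t) v = Ly"
    if "\<forall>v\<in>leaves t. dec t v = Ly" for t k
    using that by (induction k) (simp_all add: ball_leaves_Node[where P = "\<lambda>d. d = Ly"])
  then show ?case
    using Node by (simp add: ball_leaves_Node[where P = "\<lambda>d. d = Ly"])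
qed

lemma rootdec_sPN_tree:
  assumes "2 \<le> rootdec t"
  shows "rootdec (sPN_tree t) = Lx"
proof (cases t)
  case (Node n ts)
  with assms obtain k where "n = Suc (Suc k)"
    by (auto simp: numeral_2_eq_2 Suc_le_eq dest!: less_imp_Suc_add)
  with Node show ?thesis by simp
qed

section \<open>Stability of the convergent subspaces over a subfield\<close>

context
  fixes K :: "real set"
  assumes K: "real_subfield K"
begin

lemma free_space_bvec: "b \<in> B \<Longrightarrow> bvec b \<in> free_space K B"
  using K by (auto simp: free_space_def lookup_single when_def real_subfield_def)

lemma free_space_scale: "c \<in> K \<Longrightarrow> p \<in> free_space K B \<Longrightarrow> scale c p \<in> free_space K B"
  using K by (auto simp: free_space_def real_subfield_def in_keys_iff)

lemma free_space_add: "p \<in> free_space K B \<Longrightarrow> q \<in> free_space K B \<Longrightarrow> p + q \<in> free_space K B"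
  using K Poly_Mapping.keys_add[of p q]
  by (fastforce simp: free_space_def real_subfield_def lookup_add)

lemma K_diff: "a \<in> K \<Longrightarrow> b \<in> K \<Longrightarrow> a - b \<in> K"
  using K unfolding real_subfield_def by (metis diff_conv_add_uminus)

lemma free_space_diff: "p \<in> free_space K B \<Longrightarrow> q \<in> free_space K B \<Longrightarrow> p - q \<in> free_space K B"
  using Poly_Mapping.keys_diff[of p q]
  by (fastforce simp: free_space_def K_diff lookup_minus)

lemma free_space_0: "0 \<in> free_space K B"
  using K by (auto simp: free_space_def real_subfield_def)

lemma free_space_sum: "(\<And>a. a \<in> A \<Longrightarrow> f a \<in> free_space K B) \<Longrightarrow> sum f A \<in> free_space K B"
  by (induction A rule: infinite_finite_induct) (auto intro: free_space_0 free_space_add)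

lemma of_nat_in_K: "real n \<in> K"
  using K by (induction n) (auto simp: real_subfield_def add.commute)

lemma free_space_lin_ext:
  assumes "p \<in> free_space K B" "\<And>b. b \<in> B \<Longrightarrow> f b \<in> free_space K B'"
  shows "lin_ext f p \<in> free_space K B'"
  unfolding lin_ext_def using assms
  by (intro free_space_sum free_space_scale) (auto simp: free_space_def)

lemma free_space_bilin_ext:
  assumes "p \<in> free_space K A" "q \<in> free_space K B"
    and "\<And>a b. a \<in> A \<Longrightarrow> b \<in> B \<Longrightarrow> f a b \<in> free_space K C"
  shows "bilin_ext f p q \<in> free_space K C"
  unfolding bilin_ext_def using assms by (blast intro: free_space_lin_ext)

lemma free_space_prepend:
  assumes "p \<in> free_space K A" "\<And>w. w \<in> A \<Longrightarrow> a # w \<in> B"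
  shows "prepend a p \<in> free_space K B"
  unfolding prepend_def using assms by (blast intro: free_space_lin_ext free_space_bvec)

lemma qsh_word_free_space:
  "set u \<subseteq> {1..} \<Longrightarrow> set v \<subseteq> {1..} \<Longrightarrow> qsh_word u v \<in> free_space K {w. set w \<subseteq> {1..}}"
proof (induction u v rule: qsh_word.induct)
  case (3 a u b v)
  have *: "c \<ge> 1 \<Longrightarrow> p \<in> free_space K {w. set w \<subseteq> {1..}} \<Longrightarrow> prepend c p \<in> free_space K {w. set w \<subseteq> {1..}}" for c p
    by (erule free_space_prepend) auto
  show ?case
    using 3 by (auto intro!: free_space_add * simp del: One_nat_def)
qed (auto intro!: free_space_bvec simp del: One_nat_def)

text \<open>Prepending the root decoration fixes the first letter, which decides convergence; of the
  branches only the positivity of their letters has to be known.\<close>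

lemma flat1_tree_free_space:
  "\<forall>d\<in>set_ptree t. 1 \<le> d \<Longrightarrow>
     flat1_tree t \<in> free_space K {w. set w \<subseteq> {1..} \<and> w \<noteq> [] \<and> hd w = rootdec t}"
proof (induction t)
  case (Node n ts)
  have "qsh_forest ts \<in> free_space K {w. set w \<subseteq> {1..}}"
    using Node
  proof (induction ts)
    case (Cons t ts)
    have "flat1_tree t \<in> free_space K {w. set w \<subseteq> {1..} \<and> w \<noteq> [] \<and> hd w = rootdec t}"
      using Cons.prems by auto
    then have "flat1_tree t \<in> free_space K {w. set w \<subseteq> {1..}}"
      by (rule subsetD[OF free_space_mono, rotated]) auto
    moreover have "qsh_forest ts \<in> free_space K {w. set w \<subseteq> {1..}}"
      using Cons by auto
    ultimately show ?case
      unfolding qsh_forest_Cons qsh_def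
      by (rule free_space_bilin_ext) (simp add: qsh_word_free_space del: One_nat_def)
  qed (auto intro: free_space_bvec)
  then show ?case
    unfolding flat1_tree_Node using Node.prems by (auto elim!: free_space_prepend simp del: One_nat_def)
qed

text \<open>The last letter of each shuffled word is the last letter of one of the two
  factors.\<close>

lemma sh_word_free_space:
  fixes u v :: "xy list"
  shows "u = [] \<or> last u = Ly \<Longrightarrow> v = [] \<or> last v = Ly \<Longrightarrow> u \<noteq> [] \<or> v \<noteq> [] \<Longrightarrow>
    sh_word u v \<in> free_space K {w. w \<noteq> [] \<and> last w = Ly}"
proof (induction u v rule: sh_word.induct)
  case (3 a u b v)
  have *: "p \<in> free_space K {w. w \<noteq> [] \<and> last w = Ly} \<Longrightarrow>
      prepend c p \<in> free_space K {w. w \<noteq> [] \<and> last w = Ly}" for c and p :: "xy list lc"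
    by (erule free_space_prepend) auto
  have "u = [] \<or> last u = Ly" "v = [] \<or> last v = Ly"
    using 3 by (auto split: if_splits)
  then show ?case
    using 3 by (auto intro!: free_space_add *)
qed (auto intro: free_space_bvec)

lemma flat0_tree_free_space:
  "\<forall>v\<in>leaves t. dec t v = Ly \<Longrightarrow>
     flat0_tree t \<in> free_space K {w. w \<noteq> [] \<and> hd w = rootdec t \<and> last w = Ly}"
proof (induction t)
  case (Node e ts)
  let ?E = "{w. w \<noteq> [] \<and> last w = Ly}"
  \<comment> \<open>\<open>?EN\<close> admits the empty word, because no branch may be left after
    the first one.\<close>
  let ?EN = "{w. w = [] \<or> last w = Ly}"
  have *: "foldr sh (map flat0_tree ts) (bvec []) \<in> free_space K ?E"
    if "ts \<noteq> []" "\<forall>t\<in>set ts. flat0_tree t \<in> free_space K ?E" for ts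
    using that
  proof (induction ts)
    case (Cons t ts)
    have "foldr sh (map flat0_tree ts) (bvec []) \<in> free_space K ?EN"
    proof (cases "ts = []")
      case False
      then have "foldr sh (map flat0_tree ts) (bvec []) \<in> free_space K ?E"
        using Cons by auto
      then show ?thesis
        by (rule subsetD[OF free_space_mono, rotated]) auto
    qed (auto intro: free_space_bvec)
    with _ have "bilin_ext sh_word (flat0_tree t) (foldr sh (map flat0_tree ts) (bvec [])) \<in> free_space K ?E"
      by (rule free_space_bilin_ext[where A = ?E]) (use Cons.prems in \<open>simp_all add: sh_word_free_space\<close>)
    then show ?case by (simp add: sh_def)
  qed simp
  show ?case
  proof (cases "ts = []")
    case True
    then show ?thesis
      using Node.prems by (auto simp: ball_leaves_Node[where P = "\<lambda>d. d = Ly"] intro!: free_space_bvec)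
  next
    case False
    have "flat0_tree t \<in> free_space K ?E" if "t \<in> set ts" for t
    proof -
      have "flat0_tree t \<in> free_space K {w. w \<noteq> [] \<and> hd w = rootdec t \<and> last w = Ly}"
        using that Node False by (auto simp: ball_leaves_Node[where P = "\<lambda>d. d = Ly"])
      then show ?thesis
        by (rule subsetD[OF free_space_mono, rotated]) auto
    qed
    then have "foldr sh (map flat0_tree ts) (bvec []) \<in> free_space K ?E"
      using False * by auto
    then show ?thesis
      unfolding flat0_tree.simps by (rule free_space_prepend) auto
  qed
qed

text \<open>All changes happen above the stem, which has at least one vertex, so the root decoration
  survives. In the sums \<open>i\<close> stays below \<open>na\<close> or \<open>nb\<close>, which
  keeps \<open>na + nb - i\<close> positive, and the coefficients are natural numbers, hence in
  \<open>K\<close>.\<close>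

lemma err_free_space:
  assumes "\<forall>d\<in>set_ptree T. 1 \<le> d"
  shows "err T \<in> free_space K {t. (\<forall>d\<in>set_ptree t. 1 \<le> d) \<and> rootdec t = rootdec T}"
proof (cases "ladder T")
  case True
  then show ?thesis
    using decomp_ladder[OF True] by (auto simp: err_def free_space_0)
next
  case False
  from False obtain ns n na Fa nb Fb F
    where d: "decomp T = (ns, n, Node na Fa # Node nb Fb # F)"
      and T: "T = stem ns n (Node na Fa # Node nb Fb # F)"
    by (rule non_ladder_decomp)
  have eq: "T_sum T = stem ns n (Node (na + nb) (Fa @ Fb) # F)"
    by (simp add: T_sum_def d)
  show ?thesis
    unfolding err_def d prod.case list.case ptree.case eq using assms unfolding T
    by (intro free_space_diff free_space_sum free_space_scale of_nat_in_K free_space_bvec)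
       (auto simp: set_ptree_stem rootdec_stem)
qed

lemma set_ptree_pr:
  "\<forall>d\<in>set_ptree T. 1 \<le> d \<Longrightarrow> U \<in> set_ptree (pr T) \<Longrightarrow>
     (\<forall>d\<in>set_ptree U. 1 \<le> d) \<and> rootdec U = rootdec T"
proof (induction T rule: pr.induct)
  case (1 T)
  show ?case
  proof (cases "ladder T")
    case True
    then show ?thesis using 1 by (simp add: pr.simps)
  next
    case False
    from False obtain ns n na Fa nb Fb F
      where d: "decomp T = (ns, n, Node na Fa # Node nb Fb # F)"
        and T: "T = stem ns n (Node na Fa # Node nb Fb # F)"
      by (rule non_ladder_decomp)
    have r: "rootdec (T_sum T) = rootdec T" "rootdec (T_up_ab T) = rootdec T" "rootdec (T_up_ba T) = rootdec T"
      unfolding T_sum_def T_up_ab_def T_up_ba_def d by (simp_all add: T rootdec_stem)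
    have "U = T \<or> U \<in> set_ptree (pr (T_sum T)) \<or> U \<in> set_ptree (pr (T_up_ab T)) \<or> U \<in> set_ptree (pr (T_up_ba T))"
      using 1(5) False by (simp add: pr.simps[of T])
    moreover have "\<forall>d\<in>set_ptree (T_sum T). 1 \<le> d" "\<forall>d\<in>set_ptree (T_up_ab T). 1 \<le> d"
      "\<forall>d\<in>set_ptree (T_up_ba T). 1 \<le> d"
      using set_ptree_T_sum_up[OF False] 1(4) by blast+
    note 1(1)[OF False this(1)] 1(2)[OF False this(2)] 1(3)[OF False this(3)]
    ultimately show ?thesis
      using 1(4) unfolding r by blast
  qed
qed

lemma phi_tree_free_space:
  assumes "\<forall>d\<in>set_ptree T. 1 \<le> d"
  shows "phi_tree T \<in> free_space K {t. (\<forall>d\<in>set_ptree t. 1 \<le> d) \<and> rootdec t = rootdec T}"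
  unfolding phi_tree_def
proof (intro free_space_add free_space_bvec free_space_sum)
  fix v assume "v \<in> verts (pr T)"
  then have "dec (pr T) v \<in> set_ptree (pr T)"
    by (simp flip: dec_image_verts)
  then have *: "(\<forall>d\<in>set_ptree (dec (pr T) v). 1 \<le> d) \<and> rootdec (dec (pr T) v) = rootdec T"
    using set_ptree_pr assms by blast
  show "err (dec (pr T) v) \<in> free_space K {t. (\<forall>d\<in>set_ptree t. 1 \<le> d) \<and> rootdec t = rootdec T}"
    using err_free_space[of "dec (pr T) v"] * by simp
qed (use assms in simp)

lemma PT_N_conv_alt: "PT_N_conv K = free_space K {t. (\<forall>d\<in>set_ptree t. 1 \<le> d) \<and> rootdec t \<noteq> 1}"
  by (simp add: PT_N_conv_def ball_dec_verts)

lemma rootdec_in_set_ptree: "rootdec t \<in> set_ptree t"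
  by (cases t) simp

lemma sPT_conv: "p \<in> PT_N_conv K \<Longrightarrow> sPT p \<in> PT_xy_conv K"
proof -
  assume "p \<in> PT_N_conv K"
  \<comment> \<open>Leaves of binarised trees always carry y, so only the root decoration is
    followed through \<open>phi\<close>.\<close>
  then have "phi p \<in> free_space K {t. 2 \<le> rootdec t}"
    unfolding PT_N_conv_alt phi_def
  proof (rule free_space_lin_ext)
    fix T :: "nat ptree" assume T: "T \<in> {t. (\<forall>d\<in>set_ptree t. 1 \<le> d) \<and> rootdec t \<noteq> 1}"
    then have "1 \<le> rootdec T" "rootdec T \<noteq> 1"
      using rootdec_in_set_ptree[of T] by auto
    with T show "phi_tree T \<in> free_space K {t. 2 \<le> rootdec t}"
      by (intro subsetD[OF free_space_mono phi_tree_free_space]) auto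
  qed
  then show ?thesis
    unfolding sPT_def o_def sPN_def PT_xy_conv_def
    by (rule free_space_lin_ext) (auto intro: free_space_bvec simp: leaves_sPN_tree rootdec_sPN_tree)
qed

lemma flat1_conv: "p \<in> PT_N_conv K \<Longrightarrow> flat1 p \<in> W_N_conv K"
  unfolding PT_N_conv_alt flat1_def W_N_conv_def
  by (erule free_space_lin_ext) (rule subsetD[OF free_space_mono flat1_tree_free_space], auto)

lemma flat0_conv: "p \<in> PT_xy_conv K \<Longrightarrow> flat0 p \<in> W_xy_conv K"
  unfolding PT_xy_conv_def flat0_def W_xy_conv_def
  by (erule free_space_lin_ext) (rule subsetD[OF free_space_mono flat0_tree_free_space], auto)

lemma s_word_last: "w \<noteq> [] \<Longrightarrow> s_word w \<noteq> [] \<and> last (s_word w) = Ly"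
proof (induction w)
  case (Cons n w)
  then show ?case by (cases "w = []") (simp_all add: s_word_def)
qed simp

lemma s_word_conv:
  assumes "w \<noteq> []" "2 \<le> hd w"
  shows "hd (s_word w) = Lx \<and> last (s_word w) = Ly"
proof -
  from assms obtain k w' where "w = Suc (Suc k) # w'"
    by (cases w) (auto simp: numeral_2_eq_2 Suc_le_eq dest!: less_imp_Suc_add)
  then show ?thesis
    using s_word_last[OF assms(1)] by (simp add: s_word_def)
qed

lemma s_map_conv: "p \<in> W_N_conv K \<Longrightarrow> s_map p \<in> W_xy_conv K"
  unfolding W_N_conv_def s_map_def W_xy_conv_def
proof (erule free_space_lin_ext)
  fix w :: "nat list" assume w: "w \<in> {w. set w \<subseteq> {1..} \<and> (w = [] \<or> hd w \<noteq> 1)}"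
  show "bvec (s_word w) \<in> free_space K {w. w = [] \<or> hd w = Lx \<and> last w = Ly}"
  proof (cases w)
    case Nil
    then show ?thesis by (auto simp: s_word_def intro: free_space_bvec)
  next
    case (Cons n w')
    with w have "w \<noteq> []" "2 \<le> hd w" by auto
    from s_word_conv[OF this] show ?thesis by (auto intro: free_space_bvec)
  qed
qed

lemma flat0_sPT: "p \<in> PT_N_conv K \<Longrightarrow> flat0 (sPT p) = s_map (flat1 p)"
proof -
  assume p: "p \<in> PT_N_conv K"
  have "flat0 (sPN (phi p)) = s_map (flat1 p)"
  proof (rule lin_eqI[of "\<lambda>p. flat0 (sPN (phi p))" "\<lambda>p. s_map (flat1 p)"])
    show "lin (\<lambda>p. flat0 (sPN (phi p)))"
      unfolding phi_def by (rule lin_comp[OF lin_flat0_sPN lin_lin_ext])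
    show "lin (\<lambda>p. s_map (flat1 p))"
      unfolding s_map_def flat1_def by (rule lin_comp[OF lin_lin_ext lin_lin_ext])
    fix T assume "T \<in> Poly_Mapping.keys p"
    then have "\<forall>d\<in>set_ptree T. 1 \<le> d"
      using p by (auto simp: PT_N_conv_alt free_space_def)
    then show "flat0 (sPN (phi (bvec T))) = s_map (flat1 (bvec T))"
      by (simp add: phi_def flat1_def flat0_sPN_phi_tree)
  qed
  then show ?thesis by (simp add: sPT_def)
qed

end

section \<open>Nested integrals of words and trees\<close>

definition nonneg_lc :: "'a lc \<Rightarrow> bool" where
  "nonneg_lc p \<longleftrightarrow> (\<forall>b. 0 \<le> Poly_Mapping.lookup p b)"

text \<open>\<open>ennreal\<close> sends negative coefficients to 0, so additivity of this
  evaluation is proved under \<open>nonneg_lc\<close>; the flattening of a tree satisfies that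
  condition.\<close>

definition ennval :: "('a \<Rightarrow> ennreal) \<Rightarrow> 'a lc \<Rightarrow> ennreal" where
  "ennval f p = (\<Sum>b\<in>Poly_Mapping.keys p. ennreal (Poly_Mapping.lookup p b) * f b)"

lemma nonneg_bvec: "nonneg_lc (bvec b)"
  by (simp add: nonneg_lc_def lookup_single when_def)

lemma nonneg_lc_add: "nonneg_lc p \<Longrightarrow> nonneg_lc q \<Longrightarrow> nonneg_lc (p + q)"
  by (simp add: nonneg_lc_def lookup_add)

lemma nonneg_lc_lin_ext: "nonneg_lc p \<Longrightarrow> (\<And>b. nonneg_lc (f b)) \<Longrightarrow> nonneg_lc (lin_ext f p)"
  by (auto simp: nonneg_lc_def lookup_lin_ext intro!: sum_nonneg)

lemma nonneg_lc_prepend: "nonneg_lc p \<Longrightarrow> nonneg_lc (prepend a p)"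
  unfolding prepend_def by (rule nonneg_lc_lin_ext) (simp_all add: nonneg_bvec)

lemma nonneg_lc_bilin_ext:
  "nonneg_lc p \<Longrightarrow> nonneg_lc q \<Longrightarrow> (\<And>a b. nonneg_lc (f a b)) \<Longrightarrow> nonneg_lc (bilin_ext f p q)"
  unfolding bilin_ext_def by (intro nonneg_lc_lin_ext)

lemma nonneg_lc_sh_word: "nonneg_lc (sh_word u v)"
  by (induction u v rule: sh_word.induct) (simp_all add: nonneg_bvec nonneg_lc_add nonneg_lc_prepend)

lemma nonneg_lc_qsh_word: "nonneg_lc (qsh_word u v)"
  by (induction u v rule: qsh_word.induct) (simp_all add: nonneg_bvec nonneg_lc_add nonneg_lc_prepend)

lemma nonneg_lc_foldr:
  assumes "\<And>p q. nonneg_lc p \<Longrightarrow> nonneg_lc q \<Longrightarrow> nonneg_lc (f p q)" "\<And>p. p \<in> set ps \<Longrightarrow> nonneg_lc p"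
  shows "nonneg_lc (foldr f ps (bvec b))"
  using assms(2) by (induction ps) (simp_all add: nonneg_bvec assms(1))

lemma nonneg_lc_flat0_tree: "nonneg_lc (flat0_tree t)"
  by (induction t)
     (auto intro!: nonneg_lc_prepend nonneg_lc_foldr nonneg_lc_bilin_ext nonneg_lc_sh_word simp: sh_def)

lemma nonneg_lc_flat1_tree: "nonneg_lc (flat1_tree t)"
  by (induction t)
     (auto intro!: nonneg_lc_prepend nonneg_lc_foldr nonneg_lc_bilin_ext nonneg_lc_qsh_word
       simp: qsh_def flat1_tree.simps)

lemma ennval_superset:
  assumes "finite A" "Poly_Mapping.keys p \<subseteq> A"
  shows "ennval f p = (\<Sum>b\<in>A. ennreal (Poly_Mapping.lookup p b) * f b)"
  unfolding ennval_def using assms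
  by (intro sum.mono_neutral_left) (auto simp: in_keys_iff)

lemma ennval_bvec [simp]: "ennval f (bvec b) = f b"
  by (simp add: ennval_def)

lemma ennval_add:
  assumes "nonneg_lc p" "nonneg_lc q"
  shows "ennval f (p + q) = ennval f p + ennval f q"
proof -
  let ?A = "Poly_Mapping.keys p \<union> Poly_Mapping.keys q"
  have "ennval f (p + q) = (\<Sum>b\<in>?A. ennreal (Poly_Mapping.lookup (p + q) b) * f b)"
    by (rule ennval_superset) (simp_all add: Poly_Mapping.keys_add)
  moreover have "ennval f p = (\<Sum>b\<in>?A. ennreal (Poly_Mapping.lookup p b) * f b)"
    "ennval f q = (\<Sum>b\<in>?A. ennreal (Poly_Mapping.lookup q b) * f b)"
    by (rule ennval_superset; auto)+
  ultimately show ?thesis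
    using assms by (simp add: lookup_add nonneg_lc_def ennreal_plus distrib_right sum.distrib)
qed

lemma ennval_lin_ext:
  assumes "nonneg_lc p" "\<And>b. nonneg_lc (g b)"
  shows "ennval f (lin_ext g p) = ennval (\<lambda>b. ennval f (g b)) p"
proof -
  let ?A = "Poly_Mapping.keys (lin_ext g p) \<union> (\<Union>b\<in>Poly_Mapping.keys p. Poly_Mapping.keys (g b))"
  have "ennval f (lin_ext g p) = (\<Sum>c\<in>?A. ennreal (Poly_Mapping.lookup (lin_ext g p) c) * f c)"
    by (rule ennval_superset) auto
  also have "\<dots> = (\<Sum>c\<in>?A. (\<Sum>b\<in>Poly_Mapping.keys p. ennreal (Poly_Mapping.lookup p b) * ennreal (Poly_Mapping.lookup (g b) c)) * f c)"
    using assms by (simp add: lookup_lin_ext nonneg_lc_def flip: sum_ennreal ennreal_mult)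
  also have "\<dots> = (\<Sum>b\<in>Poly_Mapping.keys p. ennreal (Poly_Mapping.lookup p b) * (\<Sum>c\<in>?A. ennreal (Poly_Mapping.lookup (g b) c) * f c))"
    unfolding sum_distrib_left sum_distrib_right
    by (subst sum.swap) (simp add: mult_ac)
  also have "\<dots> = ennval (\<lambda>b. ennval f (g b)) p"
    unfolding ennval_def[of _ p]
    by (intro sum.cong refl arg_cong2[where f = "(*)"] ennval_superset[symmetric]) auto
  finally show ?thesis .
qed

lemma ennval_mult_right: "ennval (\<lambda>b. f b * c) p = ennval f p * c"
  and ennval_mult_left: "ennval (\<lambda>b. c * f b) p = c * ennval f p"
  by (simp_all add: ennval_def sum_distrib_left sum_distrib_right mult_ac)

lemma ennval_prepend: "nonneg_lc p \<Longrightarrow> ennval f (prepend a p) = ennval (\<lambda>u. f (a # u)) p"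
  unfolding prepend_def by (simp add: ennval_lin_ext nonneg_bvec)

lemma ennval_bilin_ext:
  assumes "nonneg_lc p" "nonneg_lc q" "\<And>u v. nonneg_lc (h u v)" "\<And>u v. ennval f (h u v) = f u * f v"
  shows "ennval f (bilin_ext h p q) = ennval f p * ennval f q"
  unfolding bilin_ext_def using assms
  by (simp add: ennval_lin_ext nonneg_lc_lin_ext ennval_mult_left ennval_mult_right)

text \<open>The passage back to real values: finiteness on the support is what makes
  \<open>enn2real\<close> respect sums and products here.\<close>

lemma enn2real_ennval:
  assumes "nonneg_lc p" "\<And>b. b \<in> Poly_Mapping.keys p \<Longrightarrow> f b < top"
  shows "enn2real (ennval f p) = lin_val (\<lambda>b. enn2real (f b)) p"
proof -
  have "ennval f p = (\<Sum>b\<in>Poly_Mapping.keys p. ennreal (Poly_Mapping.lookup p b * enn2real (f b)))"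
    unfolding ennval_def using assms
    by (intro sum.cong refl) (simp add: ennreal_mult nonneg_lc_def)
  also have "\<dots> = ennreal (lin_val (\<lambda>b. enn2real (f b)) p)"
    using assms(1) by (simp add: lin_val_def nonneg_lc_def)
  finally show ?thesis
    using assms(1) by (simp add: lin_val_def nonneg_lc_def sum_nonneg)
qed

text \<open>Common setting for series and integrals, with \<open>w d\<close> the density attached to
  the letter \<open>d\<close>. Second countability makes the relation \<open>s < r\<close>
  measurable on the product; sigma-finiteness gives Fubini's theorem.\<close>

locale nested_integral = sigma_finite_measure M
  for M :: "'b::{second_countable_topology, linorder_topology} measure" +
  fixes w :: "'a \<Rightarrow> 'b \<Rightarrow> ennreal"
  assumes sets_M [measurable_cong, simp]: "sets M = sets borel"
    and w_measurable [measurable]: "w d \<in> borel_measurable borel"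
begin

lemma space_M [simp]: "space M = UNIV"
  using sets_eq_imp_space_eq[OF sets_M] by simp

text \<open>\<open>S\<close> is the range of the outermost variable, and each further variable lies
  below its predecessor. Keeping \<open>S\<close> as an argument treats a full integral and its
  inner integrals alike.\<close>

fun word_val :: "'a list \<Rightarrow> 'b set \<Rightarrow> ennreal" where
  "word_val [] S = 1"
| "word_val (d # u) S = (\<integral>\<^sup>+ r. w d r * word_val u {..<r} * indicator S r \<partial>M)"

fun tree_val :: "'a ptree \<Rightarrow> 'b set \<Rightarrow> ennreal" where
  "tree_val (Node d ts) S = (\<integral>\<^sup>+ r. w d r * prod_list (map (\<lambda>t. tree_val t {..<r}) ts) * indicator S r \<partial>M)"

lemma measurable_below:
  assumes [measurable]: "f \<in> borel_measurable borel"
  shows "(\<lambda>r. \<integral>\<^sup>+ s. f s * indicator {..<r} s \<partial>M) \<in> borel_measurable borel"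
proof -
  \<comment> \<open>As a comparison of two coordinates, the moving domain of integration becomes
    jointly measurable.\<close>
  have "(\<lambda>(r, s). f s * indicator {..<r} s) = (\<lambda>x. f (snd x) * (if snd x < fst x then 1 else (0::ennreal)))"
    by (auto simp: fun_eq_iff)
  also have "\<dots> \<in> borel_measurable (borel \<Otimes>\<^sub>M M)"
    by measurable
  finally show ?thesis
    by (rule borel_measurable_nn_integral)
qed

lemma word_val_measurable [measurable]: "(\<lambda>r. word_val u {..<r}) \<in> borel_measurable borel"
  by (induction u) (auto intro!: measurable_below)

lemma tree_val_measurable [measurable]: "(\<lambda>r. tree_val t {..<r}) \<in> borel_measurable borel"
proof (induction t)
  case (Node d ts)
  then have [measurable]: "(\<lambda>r. prod_list (map (\<lambda>t. tree_val t {..<r}) ts)) \<in> borel_measurable borel"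
    by (induction ts) auto
  show ?case
    by (auto intro!: measurable_below)
qed

text \<open>Once the larger of two variables lies in such a set, so does the smaller; splitting a
  product by the order of its variables rests on this.\<close>

definition lower :: "'b set \<Rightarrow> bool" where
  "lower S \<longleftrightarrow> S \<in> sets borel \<and> (\<forall>r\<in>S. {..<r} \<subseteq> S)"

lemma lower_lessThan: "lower {..<r}" and lower_UNIV: "lower UNIV"
  by (auto simp: lower_def)

lemma product_formula:
  assumes [measurable]: "f \<in> borel_measurable borel" "g \<in> borel_measurable borel" and S: "lower S"
  shows "(\<integral>\<^sup>+ r. f r * indicator S r \<partial>M) * (\<integral>\<^sup>+ s. g s * indicator S s \<partial>M) =
      (\<integral>\<^sup>+ r. f r * (\<integral>\<^sup>+ s. g s * indicator {..<r} s \<partial>M) * indicator S r \<partial>M)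
    + (\<integral>\<^sup>+ s. g s * (\<integral>\<^sup>+ r. f r * indicator {..<s} r \<partial>M) * indicator S s \<partial>M)
    + (\<integral>\<^sup>+ r. f r * g r * emeasure M {r} * indicator S r \<partial>M)"
proof -
  interpret P: pair_sigma_finite M M ..
  have [measurable]: "S \<in> sets borel" and S': "\<And>r s. r \<in> S \<Longrightarrow> s < r \<Longrightarrow> s \<in> S"
    using S by (auto simp: lower_def)
  have [measurable]: "(\<lambda>x. indicator S (fst x) :: ennreal) \<in> borel_measurable (borel \<Otimes>\<^sub>M borel)"
    "(\<lambda>x. indicator S (snd x) :: ennreal) \<in> borel_measurable (borel \<Otimes>\<^sub>M borel)"
    by measurable
  \<comment> \<open>On each region the indicator of \<open>S\<close> is kept for one variable only,
    the larger one off the diagonal; \<open>lower S\<close> supplies the other.\<close>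
  let ?A = "\<lambda>r s. f r * indicator S r * (g s * (if s < r then 1 else 0)) :: ennreal"
  let ?B = "\<lambda>r s. g s * indicator S s * (f r * (if r < s then 1 else 0)) :: ennreal"
  let ?C = "\<lambda>r s. f r * indicator S r * (g s * indicator {r} s) :: ennreal"
  have [measurable]: "(\<lambda>x. ?A (fst x) (snd x)) \<in> borel_measurable (borel \<Otimes>\<^sub>M borel)"
    "(\<lambda>x. ?B (fst x) (snd x)) \<in> borel_measurable (borel \<Otimes>\<^sub>M borel)"
    by measurable
  \<comment> \<open>The indicator of the moving singleton \<open>{r}\<close> is an equality test of
    coordinates, whose joint measurability is available.\<close>
  have "(\<lambda>x. (f (fst x) * indicator S (fst x) * (g (snd x) * (if fst x = snd x then 1 else 0)) :: ennreal))
      = (\<lambda>x. ?C (fst x) (snd x))"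
    by (auto simp: fun_eq_iff indicator_def)
  moreover have "(\<lambda>x. (f (fst x) * indicator S (fst x) * (g (snd x) * (if fst x = snd x then 1 else 0)) :: ennreal))
      \<in> borel_measurable (borel \<Otimes>\<^sub>M borel)"
    by measurable
  ultimately have C [measurable]: "(\<lambda>x. ?C (fst x) (snd x)) \<in> borel_measurable (borel \<Otimes>\<^sub>M borel)"
    by simp
  have m [measurable]: "?A r \<in> borel_measurable borel" "?B r \<in> borel_measurable borel" "?C r \<in> borel_measurable borel" for r
    by measurable
  have split: "f r * indicator S r * (g s * indicator S s) = ?A r s + ?B r s + ?C r s" for r s
    using S' by (cases r s rule: linorder_cases) (auto simp: indicator_def mult_ac)
  have A: "(\<integral>\<^sup>+ s. ?A r s \<partial>M) = f r * (\<integral>\<^sup>+ s. g s * indicator {..<r} s \<partial>M) * indicator S r" for r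
    by (subst nn_integral_cmult) (auto simp: indicator_def[abs_def] of_bool_def mult_ac)
  have B: "(\<integral>\<^sup>+ r. ?B r s \<partial>M) = g s * (\<integral>\<^sup>+ r. f r * indicator {..<s} r \<partial>M) * indicator S s" for s
    by (subst nn_integral_cmult) (auto simp: indicator_def[abs_def] of_bool_def mult_ac)
  have C': "(\<integral>\<^sup>+ s. ?C r s \<partial>M) = f r * g r * emeasure M {r} * indicator S r" for r
    by (subst nn_integral_cmult) (auto simp: mult_ac)
  have i [measurable]: "(\<lambda>r. \<integral>\<^sup>+ s. ?A r s \<partial>M) \<in> borel_measurable M"
      "(\<lambda>r. \<integral>\<^sup>+ s. ?B r s \<partial>M) \<in> borel_measurable M"
      "(\<lambda>r. \<integral>\<^sup>+ s. ?C r s \<partial>M) \<in> borel_measurable M"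
    by (rule borel_measurable_nn_integral, simp only: case_prod_unfold, measurable)+
  have "(\<integral>\<^sup>+ r. f r * indicator S r \<partial>M) * (\<integral>\<^sup>+ s. g s * indicator S s \<partial>M)
      = (\<integral>\<^sup>+ r. (\<integral>\<^sup>+ s. ?A r s + ?B r s + ?C r s \<partial>M) \<partial>M)"
    by (simp flip: split add: nn_integral_cmult nn_integral_multc)
  also have "\<dots> = (\<integral>\<^sup>+ r. (\<integral>\<^sup>+ s. ?A r s \<partial>M) + (\<integral>\<^sup>+ s. ?B r s \<partial>M) + (\<integral>\<^sup>+ s. ?C r s \<partial>M) \<partial>M)"
    by (simp add: nn_integral_add)
  also have "\<dots> = (\<integral>\<^sup>+ r. (\<integral>\<^sup>+ s. ?A r s \<partial>M) \<partial>M) + (\<integral>\<^sup>+ r. (\<integral>\<^sup>+ s. ?B r s \<partial>M) \<partial>M)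
      + (\<integral>\<^sup>+ r. (\<integral>\<^sup>+ s. ?C r s \<partial>M) \<partial>M)"
    by (simp add: nn_integral_add)
  \<comment> \<open>Here the outer variable is the smaller one, so the order of integration has to
    be exchanged.\<close>
  also have "(\<integral>\<^sup>+ r. (\<integral>\<^sup>+ s. ?B r s \<partial>M) \<partial>M) = (\<integral>\<^sup>+ s. (\<integral>\<^sup>+ r. ?B r s \<partial>M) \<partial>M)"
    by (rule P.Fubini'[symmetric]) (simp add: case_prod_unfold)
  finally show ?thesis
    unfolding A B C' .
qed

end

context nested_integral
begin

lemma ennval_word_val_prepend:
  assumes "nonneg_lc p" and [measurable]: "S \<in> sets borel"
  shows "ennval (\<lambda>u. word_val u S) (prepend d p) =
    (\<integral>\<^sup>+ r. w d r * ennval (\<lambda>u. word_val u {..<r}) p * indicator S r \<partial>M)"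
proof -
  have "ennval (\<lambda>u. word_val u S) (prepend d p) = (\<Sum>u\<in>Poly_Mapping.keys p.
      \<integral>\<^sup>+ r. ennreal (Poly_Mapping.lookup p u) * (w d r * word_val u {..<r} * indicator S r) \<partial>M)"
    unfolding ennval_prepend[OF assms(1)] by (simp add: ennval_def nn_integral_cmult)
  also have "\<dots> = (\<integral>\<^sup>+ r. (\<Sum>u\<in>Poly_Mapping.keys p.
      ennreal (Poly_Mapping.lookup p u) * (w d r * word_val u {..<r} * indicator S r)) \<partial>M)"
    by (rule nn_integral_sum[symmetric]) measurable
  also have "\<dots> = (\<integral>\<^sup>+ r. w d r * ennval (\<lambda>u. word_val u {..<r}) p * indicator S r \<partial>M)"
    by (simp add: ennval_def sum_distrib_left sum_distrib_right mult_ac)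
  finally show ?thesis .
qed

lemma lower_sets: "lower S \<Longrightarrow> S \<in> sets borel"
  by (simp add: lower_def)

end

section \<open>Values of shuffle and quasi-shuffle products\<close>

locale shuffle_integral = nested_integral M w
  for M :: "'b::{second_countable_topology, linorder_topology} measure" and w :: "xy \<Rightarrow> 'b \<Rightarrow> ennreal" +
  assumes emeasure_singleton: "emeasure M {r} = 0"
begin

text \<open>Points are null, so the diagonal term of \<open>product_formula\<close> vanishes and the
  other two are the terms of the shuffle recursion.\<close>

lemma word_val_sh_word:
  "lower S \<Longrightarrow> ennval (\<lambda>u. word_val u S) (sh_word u v) = word_val u S * word_val v S"
proof (induction u v arbitrary: S rule: sh_word.induct)
  case (3 a u b v)
  have "word_val (a # u) S * word_val (b # v) S =
        (\<integral>\<^sup>+ r. w a r * word_val u {..<r} * word_val (b # v) {..<r} * indicator S r \<partial>M)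
      + (\<integral>\<^sup>+ r. w b r * word_val v {..<r} * word_val (a # u) {..<r} * indicator S r \<partial>M)"
    using product_formula[OF _ _ 3(3), of "\<lambda>r. w a r * word_val u {..<r}" "\<lambda>r. w b r * word_val v {..<r}"]
    by (simp add: emeasure_singleton)
  also have "\<dots> = ennval (\<lambda>u. word_val u S) (sh_word (a # u) (b # v))"
    unfolding sh_word.simps
    by (simp only: ennval_add nonneg_lc_prepend nonneg_lc_sh_word ennval_word_val_prepend lower_sets[OF 3(3)]
        3(1,2)[OF lower_lessThan] mult.assoc mult.commute[of "word_val (a # u) _"])
  finally show ?case ..
qed simp_all

lemma word_val_sh:
  "nonneg_lc p \<Longrightarrow> nonneg_lc q \<Longrightarrow> lower S \<Longrightarrow>
    ennval (\<lambda>u. word_val u S) (sh p q) = ennval (\<lambda>u. word_val u S) p * ennval (\<lambda>u. word_val u S) q"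
  unfolding sh_def by (rule ennval_bilin_ext) (simp_all add: nonneg_lc_sh_word word_val_sh_word)

text \<open>Below a fixed root variable the branches are independent, so their integrals multiply,
  and \<open>word_val_sh\<close> reads this product as the value of a shuffle.\<close>

lemma tree_val_flat0: "lower S \<Longrightarrow> tree_val t S = ennval (\<lambda>u. word_val u S) (flat0_tree t)"
proof (induction t arbitrary: S)
  case (Node e ts)
  have nn: "nonneg_lc (foldr sh (map flat0_tree ts) (bvec []))" for ts
    by (rule nonneg_lc_foldr) (auto simp: sh_def nonneg_lc_bilin_ext nonneg_lc_sh_word nonneg_lc_flat0_tree)
  have "prod_list (map (\<lambda>t. tree_val t {..<r}) ts)
      = ennval (\<lambda>u. word_val u {..<r}) (foldr sh (map flat0_tree ts) (bvec []))" for r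
    using Node.IH[OF _ lower_lessThan]
  proof (induction ts)
    case (Cons t ts)
    then show ?case by (simp add: word_val_sh nn nonneg_lc_flat0_tree lower_lessThan)
  qed simp
  then show ?case
    using Node.prems by (simp add: ennval_word_val_prepend nn lower_sets)
qed

end

locale quasi_shuffle_integral = nested_integral M w
  for M :: "'b::{second_countable_topology, linorder_topology} measure" and w :: "nat \<Rightarrow> 'b \<Rightarrow> ennreal" +
  assumes emeasure_singleton: "emeasure M {r} = 1"
    and w_add: "w (a + b) r = w a r * w b r"
begin

text \<open>Points have mass 1, so the diagonal term survives; by \<open>w_add\<close> the two
  weights on it form the weight of the contracted letter \<open>a + b\<close>.\<close>

lemma word_val_qsh_word:
  "lower S \<Longrightarrow> ennval (\<lambda>u. word_val u S) (qsh_word u v) = word_val u S * word_val v S"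
proof (induction u v arbitrary: S rule: qsh_word.induct)
  case (3 a u b v)
  have "word_val (a # u) S * word_val (b # v) S =
        (\<integral>\<^sup>+ r. w a r * word_val u {..<r} * word_val (b # v) {..<r} * indicator S r \<partial>M)
      + (\<integral>\<^sup>+ r. w b r * word_val v {..<r} * word_val (a # u) {..<r} * indicator S r \<partial>M)
      + (\<integral>\<^sup>+ r. (w a r * word_val u {..<r}) * (w b r * word_val v {..<r}) * indicator S r \<partial>M)"
    using product_formula[OF _ _ 3(4), of "\<lambda>r. w a r * word_val u {..<r}" "\<lambda>r. w b r * word_val v {..<r}"]
    by (simp add: emeasure_singleton)
  also have "\<dots> = ennval (\<lambda>u. word_val u S) (qsh_word (a # u) (b # v))"
    unfolding qsh_word.simps
    by (simp only: ennval_add nonneg_lc_add nonneg_lc_prepend nonneg_lc_qsh_word ennval_word_val_prepend lower_sets[OF 3(4)]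
        3(1,2,3)[OF lower_lessThan] mult.assoc mult.commute[of "word_val (a # u) _"] w_add
        mult.left_commute[of "w b _" "word_val u _"])
  finally show ?case ..
qed simp_all

lemma tree_val_flat1: "lower S \<Longrightarrow> tree_val t S = ennval (\<lambda>u. word_val u S) (flat1_tree t)"
proof (induction t arbitrary: S)
  case (Node n ts)
  have nn: "nonneg_lc (qsh_forest ts)" for ts
    unfolding qsh_forest_def
    by (rule nonneg_lc_foldr) (auto simp: qsh_def nonneg_lc_bilin_ext nonneg_lc_qsh_word nonneg_lc_flat1_tree)
  have "prod_list (map (\<lambda>t. tree_val t {..<r}) ts) = ennval (\<lambda>u. word_val u {..<r}) (qsh_forest ts)" for r
    using Node.IH[OF _ lower_lessThan]
  proof (induction ts)
    case (Cons t ts)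
    have "ennval (\<lambda>u. word_val u {..<r}) (qsh (flat1_tree t) (qsh_forest ts))
        = ennval (\<lambda>u. word_val u {..<r}) (flat1_tree t) * ennval (\<lambda>u. word_val u {..<r}) (qsh_forest ts)"
      unfolding qsh_def
      by (rule ennval_bilin_ext) (simp_all add: nn nonneg_lc_flat1_tree nonneg_lc_qsh_word word_val_qsh_word lower_lessThan)
    then show ?case using Cons by simp
  qed simp
  then show ?case
    using Node.prems by (simp add: flat1_tree_Node ennval_word_val_prepend nn lower_sets)
qed

end

text \<open>Fubini's theorem, splitting off one block of coordinates at a time. The last assumption
  says that \<open>f k\<close> reads only the coordinates in \<open>B k\<close>, which makes it
  measurable on every larger product.\<close>

lemma (in product_sigma_finite) nn_integral_prod_disjoint_UN:
  assumes "finite K" "\<And>k. k \<in> K \<Longrightarrow> finite (B k)" "disjoint_family_on B K"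
    and "\<And>k. k \<in> K \<Longrightarrow> f k \<in> borel_measurable (PiM (B k) M)"
    and "\<And>k x y. k \<in> K \<Longrightarrow> (\<And>i. i \<in> B k \<Longrightarrow> x i = y i) \<Longrightarrow> f k x = f k y"
  shows "(\<integral>\<^sup>+ x. (\<Prod>k\<in>K. f k x) \<partial>PiM (\<Union>k\<in>K. B k) M) = (\<Prod>k\<in>K. \<integral>\<^sup>+ x. f k x \<partial>PiM (B k) M)"
  using assms
proof (induction K rule: finite_induct)
  case empty
  show ?case by (simp add: PiM_empty)
next
  case (insert k K)
  let ?U = "\<Union>k\<in>K. B k"
  have disj: "B k \<inter> ?U = {}"
  proof -
    have "B k \<inter> B j = {}" if "j \<in> K" for j
      using disjoint_family_onD[OF insert.prems(2), of k j] that insert.hyps by auto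
    then show ?thesis by auto
  qed
  have fin: "finite (B k)" "finite ?U"
    using insert.hyps(1) insert.prems(1) by simp_all
  have meas: "f j \<in> borel_measurable (PiM L M)" if "B j \<subseteq> L" "j \<in> insert k K" for j L
  proof -
    have "(\<lambda>x. f j (restrict x (B j))) \<in> borel_measurable (PiM L M)"
      using measurable_compose[OF measurable_restrict_subset[OF that(1)] insert.prems(3)[OF that(2)]] .
    also have "(\<lambda>x. f j (restrict x (B j))) = f j"
      by (intro ext insert.prems(4)[OF that(2)]) simp
    finally show ?thesis .
  qed
  have meas_prod: "(\<lambda>x. \<Prod>j\<in>K. f j x) \<in> borel_measurable (PiM ?U M)"
    by (intro borel_measurable_prod_ennreal meas UN_upper insertI2)
  have "(\<integral>\<^sup>+ x. (\<Prod>j\<in>insert k K. f j x) \<partial>PiM (B k \<union> ?U) M)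
      = (\<integral>\<^sup>+ x. (\<integral>\<^sup>+ y. (\<Prod>j\<in>insert k K. f j (merge (B k) ?U (x, y))) \<partial>PiM ?U M) \<partial>PiM (B k) M)"
  proof (intro product_nn_integral_fold[OF disj fin] borel_measurable_prod_ennreal meas)
    show "B j \<subseteq> B k \<union> ?U" if "j \<in> insert k K" for j
      using that by auto
  qed
  also have "\<dots> = (\<integral>\<^sup>+ x. (\<integral>\<^sup>+ y. f k x * (\<Prod>j\<in>K. f j y) \<partial>PiM ?U M) \<partial>PiM (B k) M)"
  proof (intro nn_integral_cong)
    fix x y
    have "f k (merge (B k) ?U (x, y)) = f k x"
      by (rule insert.prems(4)) (auto simp: merge_def)
    moreover have "f j (merge (B k) ?U (x, y)) = f j y" if "j \<in> K" for j
      using that disj by (intro insert.prems(4)) (auto simp: merge_def)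
    ultimately show "(\<Prod>j\<in>insert k K. f j (merge (B k) ?U (x, y))) = f k x * (\<Prod>j\<in>K. f j y)"
      using insert.hyps by simp
  qed
  also have "\<dots> = (\<integral>\<^sup>+ x. f k x \<partial>PiM (B k) M) * (\<integral>\<^sup>+ y. (\<Prod>j\<in>K. f j y) \<partial>PiM ?U M)"
    by (simp only: nn_integral_cmult[OF meas_prod] nn_integral_multc[OF meas[OF order_refl insertI1]])
  also have "(\<integral>\<^sup>+ y. (\<Prod>j\<in>K. f j y) \<partial>PiM ?U M) = (\<Prod>j\<in>K. \<integral>\<^sup>+ x. f j x \<partial>PiM (B j) M)"
  proof (rule insert.IH)
    show "disjoint_family_on B K"
      using insert.prems(2) by (rule disjoint_family_on_mono[rotated]) auto
    fix j assume "j \<in> K"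
    then have j: "j \<in> insert k K" by simp
    show "finite (B j)" "f j \<in> borel_measurable (PiM (B j) M)"
      by (rule insert.prems(1,3)[OF j])+
    show "f j x = f j y" if "\<And>i. i \<in> B j \<Longrightarrow> x i = y i" for x y
      by (rule insert.prems(4)[OF j that])
  qed
  finally show ?case
    using insert.hyps by simp
qed

text \<open>
  Here \<open>p\<close> is the address of the root of \<open>t\<close> in a surrounding tree, so that Fubini's theorem can descend to
  subtrees without reindexing the coordinates.
\<close>

definition order_reversing :: "'a ptree \<Rightarrow> nat list \<Rightarrow> (nat list \<Rightarrow> 'b::linorder) \<Rightarrow> bool" where
  "order_reversing t p \<tau> \<longleftrightarrow>
     (\<forall>u\<in>verts t. \<forall>v\<in>verts t. strict_prefix u v \<longrightarrow> \<tau> (p @ v) < \<tau> (p @ u))"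

lemma Nil_in_verts [simp]: "[] \<in> verts t"
  by (cases t) simp

text \<open>It suffices to compare the root with its children; deeper vertices follow by
  transitivity within each subtree.\<close>

lemma order_reversing_Node:
  "order_reversing (Node a ts) p \<tau> \<longleftrightarrow>
     (\<forall>i<length ts. \<tau> (p @ [i]) < \<tau> p \<and> order_reversing (ts ! i) (p @ [i]) \<tau>)"
proof
  assume l: "order_reversing (Node a ts) p \<tau>"
  show "\<forall>i<length ts. \<tau> (p @ [i]) < \<tau> p \<and> order_reversing (ts ! i) (p @ [i]) \<tau>"
  proof (intro allI impI conjI)
    fix i assume i: "i < length ts"
    then have v: "i # v \<in> verts (Node a ts)" if "v \<in> verts (ts ! i)" for v
      using that by auto
    show "\<tau> (p @ [i]) < \<tau> p"
      using l v[OF Nil_in_verts] unfolding order_reversing_def by fastforce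
    show "order_reversing (ts ! i) (p @ [i]) \<tau>"
      unfolding order_reversing_def
    proof (intro ballI impI)
      fix u v' assume "u \<in> verts (ts ! i)" "v' \<in> verts (ts ! i)" "strict_prefix u v'"
      then have "\<tau> (p @ (i # v')) < \<tau> (p @ (i # u))"
        using l v unfolding order_reversing_def by (metis strict_prefix_simps(3))
      then show "\<tau> ((p @ [i]) @ v') < \<tau> ((p @ [i]) @ u)" by simp
    qed
  qed
next
  assume r: "\<forall>i<length ts. \<tau> (p @ [i]) < \<tau> p \<and> order_reversing (ts ! i) (p @ [i]) \<tau>"
  have below: "\<tau> (p @ (i # v)) < \<tau> p" if "i < length ts" "v \<in> verts (ts ! i)" for i v
  proof (cases "v = []")
    case True
    then show ?thesis using r that by auto
  next
    case False
    then have "strict_prefix [] v" by (cases v) auto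
    then have "\<tau> ((p @ [i]) @ v) < \<tau> ((p @ [i]) @ [])"
      using r that Nil_in_verts unfolding order_reversing_def by blast
    also have "\<dots> < \<tau> p" using r that by simp
    finally show ?thesis by simp
  qed
  show "order_reversing (Node a ts) p \<tau>"
    unfolding order_reversing_def
  proof (intro ballI impI)
    fix u v assume u: "u \<in> verts (Node a ts)" and v: "v \<in> verts (Node a ts)" and uv: "strict_prefix u v"
    from uv v obtain i v' where v': "v = i # v'" "i < length ts" "v' \<in> verts (ts ! i)"
      by (cases v) auto
    show "\<tau> (p @ v) < \<tau> (p @ u)"
    proof (cases u)
      case Nil
      then show ?thesis using below v' by simp
    next
      case (Cons j u')
      with u uv v' have "j = i" "u' \<in> verts (ts ! i)" "strict_prefix u' v'"
        by auto
      then have "\<tau> ((p @ [i]) @ v') < \<tau> ((p @ [i]) @ u')"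
        using r v' unfolding order_reversing_def by blast
      then show ?thesis using v' Cons \<open>j = i\<close> by simp
    qed
  qed
qed

section \<open>Integrals over all vertex coordinates of a tree\<close>

context nested_integral
begin

sublocale coords: product_sigma_finite "\<lambda>_. M"
  by standard

definition integrand :: "'a ptree \<Rightarrow> nat list \<Rightarrow> (nat list \<Rightarrow> 'b) \<Rightarrow> ennreal" where
  "integrand t p \<tau> = (\<Prod>v\<in>verts t. w (dec t v) (\<tau> (p @ v))) * of_bool (order_reversing t p \<tau>)"

lemma integrand_Node:
  "integrand (Node a ts) p \<tau> = w a (\<tau> p) *
     (\<Prod>i<length ts. indicator {..<\<tau> p} (\<tau> (p @ [i])) * integrand (ts ! i) (p @ [i]) \<tau>)"
proof -
  have "of_bool (order_reversing (Node a ts) p \<tau>) = (\<Prod>i<length ts. indicator {..<\<tau> p} (\<tau> (p @ [i]))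
      * of_bool (order_reversing (ts ! i) (p @ [i]) \<tau>) :: ennreal)"
    unfolding order_reversing_Node by (auto simp: indicator_def)
  then show ?thesis
    unfolding integrand_def prod.verts_Node by (simp add: prod.distrib mult_ac)
qed

lemma integrand_cong:
  "(\<And>v. v \<in> verts t \<Longrightarrow> \<tau> (p @ v) = \<sigma> (p @ v)) \<Longrightarrow> integrand t p \<tau> = integrand t p \<sigma>"
  by (simp add: integrand_def order_reversing_def)

lemma coordinate_measurable:
  "i \<in> A \<Longrightarrow> (\<lambda>\<tau>. \<tau> i) \<in> borel_measurable (PiM A (\<lambda>_. M))"
  using measurable_component_singleton[of i A "\<lambda>_. M"] measurable_cong_sets[OF refl sets_M] by blast

lemma integrand_measurable:
  assumes "(@) p ` verts t \<subseteq> A"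
  shows "integrand t p \<in> borel_measurable (PiM A (\<lambda>_. M))"
proof -
  have c [measurable]: "(\<lambda>\<tau>. \<tau> (p @ v)) \<in> borel_measurable (PiM A (\<lambda>_. M))" if "v \<in> verts t" for v
    using that assms by (intro coordinate_measurable) auto
  have "(\<lambda>\<tau>. \<Prod>v\<in>verts t. w (dec t v) (\<tau> (p @ v))) \<in> borel_measurable (PiM A (\<lambda>_. M))"
    by (intro borel_measurable_prod_ennreal measurable_compose[OF c w_measurable])
  moreover have "Measurable.pred (PiM A (\<lambda>_. M)) (order_reversing t p)"
    unfolding order_reversing_def
    by (intro pred_intros_finite finite_verts pred_intros_logic borel_measurable_pred_less c) measurable
  ultimately show ?thesis
    unfolding integrand_def[abs_def] of_bool_def by measurable
qed

text \<open>The root coordinate is the outermost variable. Once it is fixed to \<open>y\<close>, the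
  subtrees occupy disjoint blocks of coordinates, and each contributes its own integral with
  \<open>S\<close> replaced by \<open>{..<y}\<close>.\<close>

lemma nn_integral_integrand:
  assumes [measurable]: "S \<in> sets borel"
  shows "(\<integral>\<^sup>+ \<tau>. indicator S (\<tau> p) * integrand t p \<tau> \<partial>PiM ((@) p ` verts t) (\<lambda>_. M)) = tree_val t S"
  using assms
proof (induction t arbitrary: p S)
  case (Node a ts)
  note [measurable] = Node.prems
  let ?B = "\<lambda>i. (@) (p @ [i]) ` verts (ts ! i)"
  let ?U = "\<Union>i<length ts. ?B i"
  let ?f = "\<lambda>\<tau>. indicator S (\<tau> p) * integrand (Node a ts) p \<tau>"
  have A: "(@) p ` verts (Node a ts) = insert p ?U"
    by (auto simp: image_UN image_image)
  have p: "p \<notin> ?U" and fin: "finite ?U"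
    by auto
  have m [measurable]: "(\<lambda>\<tau>. \<tau> p) \<in> borel_measurable (PiM (insert p ?U) (\<lambda>_. M))"
    by (rule coordinate_measurable) simp
  have [measurable]: "integrand (Node a ts) p \<in> borel_measurable (PiM (insert p ?U) (\<lambda>_. M))"
    by (rule integrand_measurable) (simp only: A)
  have "?f \<in> borel_measurable (PiM (insert p ?U) (\<lambda>_. M))"
    by measurable
  then have "(\<integral>\<^sup>+ \<tau>. ?f \<tau> \<partial>PiM (insert p ?U) (\<lambda>_. M))
      = (\<integral>\<^sup>+ y. (\<integral>\<^sup>+ \<tau>. ?f (\<tau>(p := y)) \<partial>PiM ?U (\<lambda>_. M)) \<partial>M)"
    by (rule coords.product_nn_integral_insert_rev[OF fin p])
  also have "\<dots> = (\<integral>\<^sup>+ y. w a y * prod_list (map (\<lambda>t. tree_val t {..<y}) ts) * indicator S y \<partial>M)"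
  proof (intro nn_integral_cong)
    fix y
    let ?g = "\<lambda>i \<tau>. indicator {..<y} (\<tau> (p @ [i])) * integrand (ts ! i) (p @ [i]) \<tau>"
    have g: "?g i \<in> borel_measurable (PiM L (\<lambda>_. M))" if "?B i \<subseteq> L" for i L
    proof -
      have "p @ [i] \<in> L"
        using that Nil_in_verts[of "ts ! i"] by (metis append_Nil2 image_subset_iff)
      then have "(\<lambda>\<tau>. \<tau> (p @ [i])) \<in> borel_measurable (PiM L (\<lambda>_. M))"
        by (rule coordinate_measurable)
      then show ?thesis
        using integrand_measurable[OF that] by measurable
    qed
    have "?f (\<tau>(p := y)) = indicator S y * w a y * (\<Prod>i<length ts. ?g i \<tau>)" for \<tau>
    proof -
      have "integrand (ts ! i) (p @ [i]) (\<tau>(p := y)) = integrand (ts ! i) (p @ [i]) \<tau>" for i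
        by (rule integrand_cong) simp
      then show ?thesis
        by (simp add: integrand_Node mult_ac)
    qed
    then have "(\<integral>\<^sup>+ \<tau>. ?f (\<tau>(p := y)) \<partial>PiM ?U (\<lambda>_. M))
        = (\<integral>\<^sup>+ \<tau>. indicator S y * w a y * (\<Prod>i<length ts. ?g i \<tau>) \<partial>PiM ?U (\<lambda>_. M))"
      by simp
    also have "\<dots> = indicator S y * w a y * (\<integral>\<^sup>+ \<tau>. (\<Prod>i<length ts. ?g i \<tau>) \<partial>PiM ?U (\<lambda>_. M))"
      by (rule nn_integral_cmult, rule borel_measurable_prod_ennreal, rule g) auto
    also have "(\<integral>\<^sup>+ \<tau>. (\<Prod>i<length ts. ?g i \<tau>) \<partial>PiM ?U (\<lambda>_. M))
        = (\<Prod>i<length ts. \<integral>\<^sup>+ \<tau>. ?g i \<tau> \<partial>PiM (?B i) (\<lambda>_. M))"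
    proof (rule coords.nn_integral_prod_disjoint_UN)
      show "disjoint_family_on ?B {..<length ts}"
        by (auto simp: disjoint_family_on_def)
      show "?g i \<tau> = ?g i \<sigma>" if "\<And>v. v \<in> ?B i \<Longrightarrow> \<tau> v = \<sigma> v" for i \<tau> \<sigma>
      proof -
        have *: "\<tau> ((p @ [i]) @ v) = \<sigma> ((p @ [i]) @ v)" if "v \<in> verts (ts ! i)" for v
          using that by (intro \<open>\<And>v. v \<in> ?B i \<Longrightarrow> \<tau> v = \<sigma> v\<close> imageI)
        have "integrand (ts ! i) (p @ [i]) \<tau> = integrand (ts ! i) (p @ [i]) \<sigma>"
          by (rule integrand_cong) (rule *)
        then show ?thesis
          using *[OF Nil_in_verts] by simp
      qed
    qed (auto intro: g)
    also have "\<dots> = (\<Prod>i<length ts. tree_val (ts ! i) {..<y})"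
      by (intro prod.cong refl Node.IH) auto
    also have "\<dots> = prod_list (map (\<lambda>t. tree_val t {..<y}) ts)"
      by (simp add: prod.list_conv_set_nth atLeast0LessThan)
    finally show "(\<integral>\<^sup>+ \<tau>. ?f (\<tau>(p := y)) \<partial>PiM ?U (\<lambda>_. M))
        = w a y * prod_list (map (\<lambda>t. tree_val t {..<y}) ts) * indicator S y"
      by (simp only: mult_ac)
  qed
  finally show ?case
    unfolding A by simp
qed

lemma nn_integral_integrand_UNIV:
  "(\<integral>\<^sup>+ \<tau>. integrand t [] \<tau> \<partial>PiM (verts t) (\<lambda>_. M)) = tree_val t UNIV"
  using nn_integral_integrand[of UNIV "[]" t] by simp

end

section \<open>Zeta values as nested integrals\<close>

text \<open>The weight 0 at \<open>k = 0\<close> restricts summation over \<open>nat\<close> to the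
  positive integers.\<close>

definition weight_N :: "nat \<Rightarrow> nat \<Rightarrow> ennreal" where
  "weight_N n k = (if k = 0 then 0 else ennreal (1 / real k ^ n))"

text \<open>The indicator confines each variable to the unit interval, while the integration runs
  over all reals.\<close>

definition weight_xy :: "xy \<Rightarrow> real \<Rightarrow> ennreal" where
  "weight_xy e s = ennreal (g_form e s) * indicator {0..1} s"

interpretation zN: quasi_shuffle_integral "count_space UNIV" weight_N
proof -
  interpret sigma_finite_measure "count_space (UNIV :: nat set)"
    by (rule sigma_finite_measure_count_space)
  show "quasi_shuffle_integral (count_space UNIV) weight_N"
  proof
    show "sets (count_space (UNIV :: nat set)) = sets borel"
      by (simp add: sets_borel_eq_count_space)
    show "weight_N d \<in> borel_measurable borel" for d
      by (simp add: measurable_cong_sets[OF sets_borel_eq_count_space refl])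
    show "emeasure (count_space UNIV) {r :: nat} = 1" for r
      by simp
    show "weight_N (a + b) r = weight_N a r * weight_N b r" for a b r
      by (simp add: weight_N_def power_add flip: ennreal_mult)
  qed
qed

lemma g_form_measurable [measurable]: "g_form e \<in> borel_measurable borel"
proof (cases e)
  case Lx
  have "g_form Lx = (\<lambda>x. 1 / x)" by (simp add: fun_eq_iff)
  with Lx show ?thesis by simp
next
  case Ly
  have "g_form Ly = (\<lambda>x. 1 / (1 - x))" by (simp add: fun_eq_iff)
  with Ly show ?thesis by simp
qed

interpretation xy: shuffle_integral lborel weight_xy
proof
  show "weight_xy d \<in> borel_measurable borel" for d
    unfolding weight_xy_def by measurable
qed simp_all

lemma g_form_nonneg: "s \<in> {0..1} \<Longrightarrow> 0 \<le> g_form e s"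
  by (cases e) auto

text \<open>In the divergent case both sides are 0 by convention: \<open>infsum\<close> by default,
  and the right side because \<open>enn2real\<close> sends infinity to 0.\<close>

lemma infsum_eq_nn_integral:
  assumes "\<And>x. x \<in> A \<Longrightarrow> 0 \<le> f x"
  shows "infsum f A = enn2real (\<integral>\<^sup>+ x. ennreal (f x) \<partial>count_space A)"
proof -
  have *: "f summable_on A \<longleftrightarrow> Infinite_Set_Sum.abs_summable_on f A"
    using summable_on_iff_abs_summable_on_real[of f A] abs_summable_equivalent[of f A] by (rule trans)
  have "infsum f A = integral\<^sup>L (count_space A) f"
  proof (cases "f summable_on A")
    case True
    then show ?thesis
      using infsetsum_infsum[of f A] unfolding * infsetsum_def by simp
  next
    case False
    then show ?thesis
      using infsum_not_exists[OF False] unfolding * abs_summable_on_def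
      by (simp add: not_integrable_integral_eq)
  qed
  also have "\<dots> = enn2real (\<integral>\<^sup>+ x. ennreal (f x) \<partial>count_space A)"
    using assms by (intro integral_eq_nn_integral) (auto simp: AE_count_space)
  finally show ?thesis .
qed

lemma prod_ennreal_indicator:
  assumes "finite V"
  shows "(\<Prod>v\<in>V. if P v then ennreal (f v) else 0) = (if \<forall>v\<in>V. P v then \<Prod>v\<in>V. ennreal (f v) else 0)"
  using assms by (induction V rule: finite_induct) auto

lemma zeta_T_tree_eq: "zeta_T_tree t = enn2real (zN.tree_val t UNIV)"
proof -
  let ?A = "{k \<in> verts t \<rightarrow>\<^sub>E {1::nat..}. \<forall>u\<in>verts t. \<forall>v\<in>verts t. strict_prefix u v \<longrightarrow> k v < k u}"
  let ?f = "\<lambda>k. \<Prod>v\<in>verts t. 1 / real (k v) ^ dec t v"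
  have "zeta_T_tree t = enn2real (\<integral>\<^sup>+ k. ennreal (?f k) \<partial>count_space ?A)"
    unfolding zeta_T_tree_def by (rule infsum_eq_nn_integral) (auto intro: prod_nonneg)
  also have "(\<integral>\<^sup>+ k. ennreal (?f k) \<partial>count_space ?A) = (\<integral>\<^sup>+ k. ennreal (?f k) * indicator ?A k \<partial>count_space UNIV)"
    by (rule nn_integral_count_space_indicator) simp
  \<comment> \<open>Positivity and order are encoded in \<open>zN.integrand\<close>; only the fixed
    default value of \<open>k\<close> outside \<open>verts t\<close> has to be kept as an
    indicator.\<close>
  also have "\<dots> = (\<integral>\<^sup>+ k. zN.integrand t [] k * indicator (verts t \<rightarrow>\<^sub>E UNIV) k \<partial>count_space UNIV)"
  proof (intro nn_integral_cong)
    fix k :: "nat list \<Rightarrow> nat"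
    have "(\<Prod>v\<in>verts t. weight_N (dec t v) (k v)) =
        (if \<forall>v\<in>verts t. 1 \<le> k v then \<Prod>v\<in>verts t. ennreal (1 / real (k v) ^ dec t v) else 0)"
      by (subst prod_ennreal_indicator[symmetric]) (auto simp: weight_N_def intro!: prod.cong)
    then have "zN.integrand t [] k =
        (if (\<forall>v\<in>verts t. 1 \<le> k v) \<and> order_reversing t [] k then ennreal (?f k) else 0)"
      by (simp add: zN.integrand_def prod_ennreal)
    then show "ennreal (?f k) * indicator ?A k = zN.integrand t [] k * indicator (verts t \<rightarrow>\<^sub>E UNIV) k"
      by (auto simp: indicator_def order_reversing_def PiE_iff)
  qed
  also have "\<dots> = (\<integral>\<^sup>+ k. zN.integrand t [] k \<partial>count_space (verts t \<rightarrow>\<^sub>E UNIV))"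
    by (subst (2) nn_integral_count_space_indicator) simp_all
  \<comment> \<open>A finite product of counting measures on a countable space is again a counting
    measure.\<close>
  also have "\<dots> = (\<integral>\<^sup>+ k. zN.integrand t [] k \<partial>PiM (verts t) (\<lambda>_. count_space UNIV))"
    by (subst count_space_PiM_finite) simp_all
  also have "\<dots> = zN.tree_val t UNIV"
    by (rule zN.nn_integral_integrand_UNIV)
  finally show ?thesis .
qed

lemma zeta_sh_T_tree_eq: "zeta_sh_T_tree t = enn2real (xy.tree_val t UNIV)"
proof -
  let ?P = "PiM (verts t) (\<lambda>_. lborel :: real measure)"
  let ?g = "\<lambda>\<tau>. \<Prod>v\<in>verts t. g_form (dec t v) (\<tau> v)"
  have *: "ennreal (indicator (Delta t) \<tau> *\<^sub>R ?g \<tau>) = xy.integrand t [] \<tau>"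
    and nonneg: "0 \<le> indicator (Delta t) \<tau> *\<^sub>R ?g \<tau>" if "\<tau> \<in> space ?P" for \<tau>
  proof -
    have D: "\<tau> \<in> Delta t \<longleftrightarrow> (\<forall>v\<in>verts t. \<tau> v \<in> {0..1}) \<and> order_reversing t [] \<tau>"
      using that by (auto simp: Delta_def order_reversing_def space_PiM PiE_iff)
    show "0 \<le> indicator (Delta t) \<tau> *\<^sub>R ?g \<tau>"
      by (auto simp: indicator_def D intro!: prod_nonneg g_form_nonneg)
    have "(\<Prod>v\<in>verts t. weight_xy (dec t v) (\<tau> v)) =
        (if \<forall>v\<in>verts t. \<tau> v \<in> {0..1} then \<Prod>v\<in>verts t. ennreal (g_form (dec t v) (\<tau> v)) else 0)"
      by (subst prod_ennreal_indicator[symmetric]) (auto simp: weight_xy_def indicator_def intro!: prod.cong)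
    moreover have "(\<Prod>v\<in>verts t. ennreal (g_form (dec t v) (\<tau> v))) = ennreal (?g \<tau>)"
      if "\<forall>v\<in>verts t. \<tau> v \<in> {0..1}"
      using that by (intro prod_ennreal g_form_nonneg) auto
    ultimately show "ennreal (indicator (Delta t) \<tau> *\<^sub>R ?g \<tau>) = xy.integrand t [] \<tau>"
      by (auto simp: xy.integrand_def D indicator_def)
  qed
  have m: "xy.integrand t [] \<in> borel_measurable ?P"
    by (rule xy.integrand_measurable) simp
  have "zeta_sh_T_tree t = integral\<^sup>L ?P (\<lambda>\<tau>. indicator (Delta t) \<tau> *\<^sub>R ?g \<tau>)"
    by (simp add: zeta_sh_T_tree_def set_lebesgue_integral_def)
  also have "\<dots> = enn2real (\<integral>\<^sup>+ \<tau>. ennreal (indicator (Delta t) \<tau> *\<^sub>R ?g \<tau>) \<partial>?P)"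
  proof (rule integral_eq_nn_integral)
    \<comment> \<open>Measurability of the real integrand is read off from
      \<open>xy.integrand\<close>, with which it agrees after \<open>enn2real\<close>.\<close>
    have "(\<lambda>\<tau>. enn2real (xy.integrand t [] \<tau>)) \<in> borel_measurable ?P"
      using m by measurable
    also have "?this \<longleftrightarrow> (\<lambda>\<tau>. indicator (Delta t) \<tau> *\<^sub>R ?g \<tau>) \<in> borel_measurable ?P"
      using *[symmetric] nonneg by (intro measurable_cong) simp
    finally show "(\<lambda>\<tau>. indicator (Delta t) \<tau> *\<^sub>R ?g \<tau>) \<in> borel_measurable ?P" .
  qed (use nonneg in auto)
  also have "(\<integral>\<^sup>+ \<tau>. ennreal (indicator (Delta t) \<tau> *\<^sub>R ?g \<tau>) \<partial>?P) = (\<integral>\<^sup>+ \<tau>. xy.integrand t [] \<tau> \<partial>?P)"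
    using * by (intro nn_integral_cong)
  finally show ?thesis
    by (simp add: xy.nn_integral_integrand_UNIV)
qed

section \<open>The iterated integral of a multiple zeta value\<close>

lemma suminf_ennreal_shift:
  fixes f :: "nat \<Rightarrow> ennreal"
  shows "(suminf (\<lambda>k. f k)) = f 0 + (suminf (\<lambda>k. f (Suc k)))"
  using sums_Suc[OF summable_sums[OF summableI[of "\<lambda>k. f (Suc k)"]]]
  by (simp add: sums_iff add.commute)

lemma zN_word_val_Cons:
  "zN.word_val (n # u) S = (suminf (\<lambda>k. weight_N n (Suc k) * zN.word_val u {..<Suc k} * indicator S (Suc k)))"
  by (simp add: nn_integral_count_space_nat suminf_ennreal_shift[of "\<lambda>k. weight_N n k * _ k * _ k"])
     (simp add: weight_N_def)

lemma suminf_geometric_tail: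
  assumes "0 \<le> s" "s < 1"
  shows "(suminf (\<lambda>j. ennreal (s ^ j) * indicator {..j} k)) = ennreal (1 / (1 - s)) * ennreal (s ^ k)"
proof -
  let ?f = "\<lambda>j. if k \<le> j then s ^ j else 0"
  have "(\<lambda>j. s ^ k * s ^ j) sums (s ^ k * (1 / (1 - s)))"
    using assms by (intro sums_mult geometric_sums) simp
  then have "(\<lambda>j. ?f (j + k)) sums (s ^ k * (1 / (1 - s)))"
    by (simp add: power_add mult.commute)
  moreover have "(\<Sum>i<k. ?f i) = 0"
    by (intro sum.neutral) auto
  ultimately have "?f sums (s ^ k * (1 / (1 - s)))"
    using sums_iff_shift[of ?f k "s ^ k * (1 / (1 - s))"] by simp
  then have "(suminf (\<lambda>j. ennreal (?f j))) = ennreal (s ^ k * (1 / (1 - s)))"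
    using assms by (intro suminf_ennreal_eq) auto
  also have "(suminf (\<lambda>j. ennreal (?f j))) = (suminf (\<lambda>j. ennreal (s ^ j) * indicator {..j} k))"
    by (intro suminf_cong) (auto simp: indicator_def)
  finally show ?thesis
    using assms by (subst ennreal_mult[symmetric]) simp_all
qed

text \<open>All terms are nonnegative, so the series is integrated termwise. Endpoints are null,
  hence the expansion of \<open>f\<close> is assumed only strictly between 0 and 1.\<close>

lemma nn_integral_power_series:
  fixes a :: "nat \<Rightarrow> ennreal" and f :: "real \<Rightarrow> ennreal"
  assumes "0 \<le> \<tau>" "\<tau> \<le> 1" and f: "\<And>s. 0 < s \<Longrightarrow> s < 1 \<Longrightarrow> f s = (suminf (\<lambda>j. ennreal (s ^ j) * a j))"
  shows "(\<integral>\<^sup>+ s. f s * indicator {0..1} s * indicator {..<\<tau>} s \<partial>lborel) =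
    (suminf (\<lambda>j. ennreal (\<tau> ^ Suc j / real (Suc j)) * a j))"
proof -
  have "(\<integral>\<^sup>+ s. f s * indicator {0..1} s * indicator {..<\<tau>} s \<partial>lborel)
      = (\<integral>\<^sup>+ s. (suminf (\<lambda>j. ennreal (s ^ j) * indicator {0..\<tau>} s * a j)) \<partial>lborel)"
  proof (rule nn_integral_cong_AE)
    show "AE s in lborel. f s * indicator {0..1} s * indicator {..<\<tau>} s
        = (suminf (\<lambda>j. ennreal (s ^ j) * indicator {0..\<tau>} s * a j))"
      using AE_lborel_singleton[of 0] AE_lborel_singleton[of \<tau>]
    proof eventually_elim
      case (elim s)
      then show ?case
        using assms by (cases "0 < s \<and> s < \<tau>") (auto simp: f indicator_def)
    qed
  qed
  also have "\<dots> = (suminf (\<lambda>j. (\<integral>\<^sup>+ s. ennreal (s ^ j) * indicator {0..\<tau>} s * a j \<partial>lborel)))"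
    by (intro nn_integral_suminf) measurable
  also have "\<dots> = (suminf (\<lambda>j. (\<integral>\<^sup>+ s. ennreal (s ^ j) * indicator {0..\<tau>} s \<partial>lborel) * a j))"
    by (intro suminf_cong nn_integral_multc) measurable
  also have "\<dots> = (suminf (\<lambda>j. ennreal (\<tau> ^ Suc j / real (Suc j)) * a j))"
  proof (intro suminf_cong arg_cong2[where f = "(*)"] refl)
    fix j
    have "(\<integral>\<^sup>+ s. ennreal (s ^ j) * indicator {0..\<tau>} s \<partial>lborel)
        = ennreal (\<tau> ^ Suc j / real (Suc j) - 0 ^ Suc j / real (Suc j))"
    proof (rule nn_integral_FTC_Icc)
      show "((\<lambda>s. s ^ Suc j / real (Suc j)) has_real_derivative x ^ j) (at x)" for x
        by (rule derivative_eq_intros refl | simp)+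
    qed (use assms in auto)
    then show "(\<integral>\<^sup>+ s. ennreal (s ^ j) * indicator {0..\<tau>} s \<partial>lborel) = ennreal (\<tau> ^ Suc j / real (Suc j))"
      by simp
  qed
  finally show ?thesis .
qed

lemma xy_word_val_Ly:
  assumes "0 \<le> \<tau>" "\<tau> \<le> 1"
    and v: "\<And>s. 0 \<le> s \<Longrightarrow> s < 1 \<Longrightarrow> ennreal (1 / (1 - s)) * xy.word_val v {..<s} = (suminf (\<lambda>j. ennreal (s ^ j) * a j))"
  shows "xy.word_val (Ly # v) {..<\<tau>} = (suminf (\<lambda>j. ennreal (\<tau> ^ Suc j / real (Suc j)) * a j))"
proof -
  have "xy.word_val (Ly # v) {..<\<tau>} =
      (\<integral>\<^sup>+ s. (ennreal (1 / (1 - s)) * xy.word_val v {..<s}) * indicator {0..1} s * indicator {..<\<tau>} s \<partial>lborel)"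
    by (simp add: weight_xy_def mult_ac)
  also have "\<dots> = (suminf (\<lambda>j. ennreal (\<tau> ^ Suc j / real (Suc j)) * a j))"
    using assms by (intro nn_integral_power_series) auto
  finally show ?thesis .
qed

text \<open>The inner series has no constant term: \<open>1 / s\<close> lowers every exponent by one
  and integration restores it, leaving a factor \<open>1 / real (Suc j)\<close>.\<close>

lemma xy_word_val_Lx:
  assumes "0 \<le> \<tau>" "\<tau> \<le> 1"
    and v: "\<And>s. 0 \<le> s \<Longrightarrow> s \<le> 1 \<Longrightarrow> xy.word_val v {..<s} = (suminf (\<lambda>j. ennreal (s ^ Suc j) * a j))"
  shows "xy.word_val (Lx # v) {..<\<tau>} = (suminf (\<lambda>j. ennreal (\<tau> ^ Suc j / real (Suc j)) * a j))"
proof -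
  have "xy.word_val (Lx # v) {..<\<tau>} =
      (\<integral>\<^sup>+ s. (ennreal (1 / s) * xy.word_val v {..<s}) * indicator {0..1} s * indicator {..<\<tau>} s \<partial>lborel)"
    by (simp add: weight_xy_def mult_ac)
  also have "\<dots> = (suminf (\<lambda>j. ennreal (\<tau> ^ Suc j / real (Suc j)) * a j))"
  proof (intro nn_integral_power_series assms)
    fix s :: real assume s: "0 < s" "s < 1"
    have "ennreal (1 / s) * (ennreal (s ^ Suc j) * a j) = ennreal (s ^ j) * a j" for j
      using s by (simp add: mult.assoc[symmetric] flip: ennreal_mult)
    then show "ennreal (1 / s) * xy.word_val v {..<s} = (suminf (\<lambda>j. ennreal (s ^ j) * a j))"
      using s by (simp add: v flip: ennreal_suminf_cmult)
  qed
  finally show ?thesis .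
qed

lemma xy_word_val_block:
  assumes "\<And>\<tau>. 0 \<le> \<tau> \<Longrightarrow> \<tau> \<le> 1 \<Longrightarrow> xy.word_val v {..<\<tau>} = (suminf (\<lambda>j. ennreal (\<tau> ^ Suc j) * a j))"
    and "0 \<le> \<tau>" "\<tau> \<le> 1"
  shows "xy.word_val (replicate k Lx @ v) {..<\<tau>} =
    (suminf (\<lambda>j. ennreal (\<tau> ^ Suc j) * (ennreal (1 / real (Suc j) ^ k) * a j)))"
  using assms(2,3)
proof (induction k arbitrary: \<tau>)
  case 0
  then show ?case using assms(1) by simp
next
  case (Suc k)
  have "xy.word_val (Lx # replicate k Lx @ v) {..<\<tau>}
      = (suminf (\<lambda>j. ennreal (\<tau> ^ Suc j / real (Suc j)) * (ennreal (1 / real (Suc j) ^ k) * a j)))"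
    by (rule xy_word_val_Lx[OF Suc.prems Suc.IH])
  also have "\<dots> = (suminf (\<lambda>j. ennreal (\<tau> ^ Suc j) * (ennreal (1 / real (Suc j) ^ Suc k) * a j)))"
  proof (intro suminf_cong)
    fix j
    have "ennreal (\<tau> ^ Suc j / real (Suc j)) * ennreal (1 / real (Suc j) ^ k)
        = ennreal (\<tau> ^ Suc j) * ennreal (1 / real (Suc j) ^ Suc k)"
      using Suc.prems by (subst (1 2) ennreal_mult[symmetric]) simp_all
    then show "ennreal (\<tau> ^ Suc j / real (Suc j)) * (ennreal (1 / real (Suc j) ^ k) * a j)
        = ennreal (\<tau> ^ Suc j) * (ennreal (1 / real (Suc j) ^ Suc k) * a j)"
      by (simp only: mult.assoc[symmetric])
  qed
  finally show ?case by simp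
qed

text \<open>Multiplication by the geometric series replaces coefficients by their partial sums. The
  two series are exchanged by viewing one of them as an integral against counting measure.\<close>

lemma geometric_partial_sums:
  fixes c :: "nat \<Rightarrow> ennreal"
  assumes "0 \<le> s" "s < 1"
  shows "ennreal (1 / (1 - s)) * (suminf (\<lambda>k. ennreal (s ^ Suc k) * c k)) =
    (suminf (\<lambda>j. ennreal (s ^ j) * (suminf (\<lambda>k. c k * indicator {..<Suc j} (Suc k)))))"
proof -
  have "ennreal (1 / (1 - s)) * (suminf (\<lambda>k. ennreal (s ^ Suc k) * c k))
      = (suminf (\<lambda>k. (suminf (\<lambda>j. ennreal (s ^ j) * indicator {..j} (Suc k))) * c k))"
    unfolding suminf_geometric_tail[OF assms] by (simp add: mult.assoc flip: ennreal_suminf_cmult)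
  also have "\<dots> = (\<integral>\<^sup>+ k. (suminf (\<lambda>j. ennreal (s ^ j) * indicator {..j} (Suc k) * c k)) \<partial>count_space UNIV)"
    by (simp add: nn_integral_count_space_nat)
  also have "\<dots> = (suminf (\<lambda>j. \<integral>\<^sup>+ k. ennreal (s ^ j) * indicator {..j} (Suc k) * c k \<partial>count_space UNIV))"
    by (rule nn_integral_suminf) simp
  also have "\<dots> = (suminf (\<lambda>j. ennreal (s ^ j) * (suminf (\<lambda>k. c k * indicator {..<Suc j} (Suc k)))))"
    by (simp add: nn_integral_count_space_nat mult_ac lessThan_Suc_atMost flip: ennreal_suminf_cmult)
  finally show ?thesis .
qed

lemma s_word_Cons: "s_word (n # u) = replicate (n - 1) Lx @ Ly # s_word u"
  by (simp add: s_word_def)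

lemma xy_word_val_s_word_step:
  assumes "1 \<le> n" "0 \<le> \<tau>" "\<tau> \<le> 1"
    and u: "\<And>s. 0 \<le> s \<Longrightarrow> s < 1 \<Longrightarrow> ennreal (1 / (1 - s)) * xy.word_val (s_word u) {..<s}
      = (suminf (\<lambda>j. ennreal (s ^ j) * zN.word_val u {..<Suc j}))"
  shows "xy.word_val (s_word (n # u)) {..<\<tau>} =
    (suminf (\<lambda>j. ennreal (\<tau> ^ Suc j) * (weight_N n (Suc j) * zN.word_val u {..<Suc j})))"
proof -
  let ?a = "\<lambda>j. ennreal (1 / real (Suc j)) * zN.word_val u {..<Suc j}"
  have "xy.word_val (Ly # s_word u) {..<\<tau>} = (suminf (\<lambda>j. ennreal (\<tau> ^ Suc j) * ?a j))"
    if "0 \<le> \<tau>" "\<tau> \<le> 1" for \<tau>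
  proof -
    have "ennreal (\<tau> ^ Suc j / real (Suc j)) = ennreal (\<tau> ^ Suc j) * ennreal (1 / real (Suc j))" for j
      using that by (subst ennreal_mult[symmetric]) simp_all
    then show ?thesis
      using xy_word_val_Ly[OF that u] by (simp only: mult.assoc)
  qed
  then have "xy.word_val (replicate (n - 1) Lx @ Ly # s_word u) {..<\<tau>} =
      (suminf (\<lambda>j. ennreal (\<tau> ^ Suc j) * (ennreal (1 / real (Suc j) ^ (n - 1)) * ?a j)))"
    by (rule xy_word_val_block) (use assms(2,3) in simp_all)
  moreover have "ennreal (1 / real (Suc j) ^ (n - 1)) * ennreal (1 / real (Suc j)) = weight_N n (Suc j)" for j
    using assms(1) by (cases n) (simp_all add: weight_N_def mult.commute flip: ennreal_mult)
  ultimately show ?thesis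
    unfolding s_word_Cons by (simp only: mult.assoc[symmetric])
qed

text \<open>The factor \<open>1 / (1 - s)\<close> turns the coefficients into truncated nested sums
  and prepares the integration for the next y. For the empty word it is the geometric series, so the
  induction starts there.\<close>

lemma xy_word_val_s_word_geometric:
  assumes "\<forall>n\<in>set u. 1 \<le> n" "0 \<le> s" "s < 1"
  shows "ennreal (1 / (1 - s)) * xy.word_val (s_word u) {..<s} = (suminf (\<lambda>j. ennreal (s ^ j) * zN.word_val u {..<Suc j}))"
  using assms
proof (induction u arbitrary: s)
  case Nil
  have "ennreal (1 / (1 - s)) = suminf (\<lambda>j. ennreal (s ^ j))"
    using suminf_geometric_tail[OF Nil.prems(2,3), of 0] by simp
  then show ?case
    by (simp only: s_word_def list.map concat.simps xy.word_val.simps zN.word_val.simps mult_1_right)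
next
  case (Cons n u)
  have "xy.word_val (s_word (n # u)) {..<s} =
      (suminf (\<lambda>j. ennreal (s ^ Suc j) * (weight_N n (Suc j) * zN.word_val u {..<Suc j})))"
    by (rule xy_word_val_s_word_step[OF _ _ _ Cons.IH]) (use Cons.prems in simp_all)
  then show ?case
    unfolding zN_word_val_Cons geometric_partial_sums[OF Cons.prems(2,3), symmetric] by (rule arg_cong)
qed

text \<open>The weights vanish outside the unit interval, and the point 1 is null.\<close>

lemma xy_word_val_UNIV:
  assumes "v \<noteq> []"
  shows "xy.word_val v UNIV = xy.word_val v {..<1}"
proof (cases v)
  case (Cons d v')
  have "AE s in lborel. weight_xy d s * xy.word_val v' {..<s} * indicator UNIV s
      = weight_xy d s * xy.word_val v' {..<s} * indicator {..<1} s"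
    using AE_lborel_singleton[of 1] by eventually_elim (auto simp: weight_xy_def indicator_def)
  with Cons show ?thesis
    by (simp add: nn_integral_cong_AE)
qed (use assms in simp)

lemma xy_word_val_s_word:
  assumes "\<forall>n\<in>set w. 1 \<le> n"
  shows "xy.word_val (s_word w) UNIV = zN.word_val w UNIV"
proof (cases w)
  case Nil
  then show ?thesis by (simp add: s_word_def)
next
  case (Cons n u)
  have "xy.word_val (s_word (n # u)) {..<1} =
      (suminf (\<lambda>j. ennreal (1 ^ Suc j) * (weight_N n (Suc j) * zN.word_val u {..<Suc j})))"
    using assms Cons by (intro xy_word_val_s_word_step xy_word_val_s_word_geometric) auto
  then show ?thesis
    unfolding Cons zN_word_val_Cons by (simp add: xy_word_val_UNIV s_word_Cons)
qed

section \<open>Finiteness on convergent words\<close>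

lemma sum_inverse_sqrt_le: "(\<Sum>k<m. 1 / sqrt (real (Suc k))) \<le> 2 * sqrt (real m)"
proof (induction m)
  case (Suc m)
  let ?a = "sqrt (real m)" and ?b = "sqrt (real (Suc m))"
  have b: "0 < ?b" "?a \<le> ?b" "?b * ?b - ?a * ?a = 1"
    by simp_all
  \<comment> \<open>Telescoping: \<open>1 / ?b\<close> is at most twice the increment
    \<open>?b - ?a\<close> of the square root.\<close>
  then have "1 = (?b - ?a) * (?b + ?a)"
    by (simp add: algebra_simps)
  also have "\<dots> \<le> (?b - ?a) * (2 * ?b)"
    using b by (intro mult_left_mono) auto
  finally have "1 / ?b \<le> 2 * (?b - ?a)"
    unfolding pos_divide_le_eq[OF b(1)] by (simp only: mult_ac)
  with Suc show ?case by simp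
qed simp

lemma weight_N_le:
  assumes "m \<le> n"
  shows "weight_N n (Suc k) \<le> ennreal (1 / real (Suc k) ^ m)"
  unfolding weight_N_def using assms
  by (auto intro!: ennreal_leI divide_left_mono power_increasing)

text \<open>
  The bound reproduces itself because the partial sums of \<open>1/\<surd>k\<close> grow like a square root again; it is weak
  enough to leave a convergent series \<open>k\<^bsup>-2\<^esup>\<surd>k\<close> in the outermost sum.
\<close>

lemma zN_word_val_le:
  assumes "\<forall>n\<in>set u. 1 \<le> n"
  shows "zN.word_val u {..<Suc N} \<le> ennreal (2 ^ length u * sqrt (real (Suc N)))"
  using assms
proof (induction u arbitrary: N)
  case Nil
  then show ?case by simp
next
  case (Cons n u)
  let ?c = "2 ^ length u :: real"
  have "zN.word_val (n # u) {..<Suc N} = (\<Sum>k<N. weight_N n (Suc k) * zN.word_val u {..<Suc k})"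
    unfolding zN_word_val_Cons
    by (subst suminf_finite[of "{..<N}"]) (auto intro!: sum.cong)
  also have "\<dots> \<le> (\<Sum>k<N. ennreal (1 / real (Suc k)) * ennreal (?c * sqrt (real (Suc k))))"
  proof (intro sum_mono mult_mono)
    fix k
    show "weight_N n (Suc k) \<le> ennreal (1 / real (Suc k))"
      using weight_N_le[of 1 n k] Cons.prems by simp
    show "zN.word_val u {..<Suc k} \<le> ennreal (?c * sqrt (real (Suc k)))"
      by (rule Cons.IH) (use Cons.prems in simp)
  qed simp_all
  also have "\<dots> = (\<Sum>k<N. ennreal (?c * (1 / sqrt (real (Suc k)))))"
  proof (intro sum.cong refl)
    fix k
    have r: "real (Suc k) = sqrt (real (Suc k)) * sqrt (real (Suc k))" "0 < sqrt (real (Suc k))"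
      by simp_all
    have "1 / (r * r) * (?c * r) = ?c * (1 / r)" if "0 < r" for r :: real
      using that by (simp add: field_simps)
    from this[OF r(2)] have "1 / real (Suc k) * (?c * sqrt (real (Suc k))) = ?c * (1 / sqrt (real (Suc k)))"
      by (simp only: r(1)[symmetric])
    then show "ennreal (1 / real (Suc k)) * ennreal (?c * sqrt (real (Suc k))) = ennreal (?c * (1 / sqrt (real (Suc k))))"
      by (subst ennreal_mult[symmetric]) simp_all
  qed
  also have "\<dots> = ennreal (?c * (\<Sum>k<N. 1 / sqrt (real (Suc k))))"
    by (subst sum_ennreal) (simp_all add: sum_distrib_left)
  also have "\<dots> \<le> ennreal (2 ^ length (n # u) * sqrt (real (Suc N)))"
  proof (rule ennreal_leI)
    have "?c * (\<Sum>k<N. 1 / sqrt (real (Suc k))) \<le> ?c * (2 * sqrt (real (Suc N)))"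
      by (intro mult_left_mono order_trans[OF sum_inverse_sqrt_le]) simp_all
    then show "?c * (\<Sum>k<N. 1 / sqrt (real (Suc k))) \<le> 2 ^ length (n # u) * sqrt (real (Suc N))"
      by simp
  qed
  finally show ?case .
qed

lemma zN_word_val_finite:
  assumes "\<forall>n\<in>set w. 1 \<le> n" "w = [] \<or> hd w \<noteq> 1"
  shows "zN.word_val w UNIV < top"
proof (cases w)
  case (Cons n u)
  let ?c = "2 ^ length u :: real"
  let ?f = "\<lambda>k. ?c * real (Suc k) powr (- 3 / 2)"
  from assms Cons have n: "2 \<le> n" and u: "\<forall>n\<in>set u. 1 \<le> n" by auto
  have "zN.word_val w UNIV \<le> (suminf (\<lambda>k. ennreal (1 / real (Suc k) ^ 2) * ennreal (?c * sqrt (real (Suc k)))))"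
    unfolding Cons zN_word_val_Cons
  proof (intro suminf_le summableI)
    fix k
    have "weight_N n (Suc k) * zN.word_val u {..<Suc k}
        \<le> ennreal (1 / real (Suc k) ^ 2) * ennreal (?c * sqrt (real (Suc k)))"
      by (rule mult_mono[OF weight_N_le[OF n] zN_word_val_le[OF u]]) simp_all
    then show "weight_N n (Suc k) * zN.word_val u {..<Suc k} * indicator UNIV (Suc k)
        \<le> ennreal (1 / real (Suc k) ^ 2) * ennreal (?c * sqrt (real (Suc k)))"
      by simp
  qed
  also have "\<dots> = (suminf (\<lambda>k. ennreal (?f k)))"
  proof (intro suminf_cong)
    fix k
    have "real (Suc k) powr (- 3 / 2) = real (Suc k) powr (1 / 2 - 2)"
      by simp
    also have "\<dots> = sqrt (real (Suc k)) / real (Suc k) ^ 2"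
      unfolding powr_diff by (simp add: powr_half_sqrt)
    finally have "?f k = 1 / real (Suc k) ^ 2 * (?c * sqrt (real (Suc k)))"
      by (simp only: times_divide_eq_left times_divide_eq_right mult_1_left)
    then show "ennreal (1 / real (Suc k) ^ 2) * ennreal (?c * sqrt (real (Suc k))) = ennreal (?f k)"
      by (subst ennreal_mult[symmetric]) simp_all
  qed
  also have "\<dots> < top"
  proof -
    have "summable (\<lambda>k. real k powr (- 3 / 2))"
      by (simp add: summable_real_powr_iff)
    then have "summable ?f"
      by (intro summable_mult) (subst summable_Suc_iff)
    then have "suminf (\<lambda>k. ennreal (?f k)) \<noteq> top"
      by (rule ennreal_suminf_neq_top) simp
    then show ?thesis
      by (simp only: less_top)
  qed
  finally show ?thesis .
qed simp

text \<open>A leading x raises the first letter by one, and a leading y inserts a new letter 1. This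
  lets finiteness pass from nested sums to all convergent words in x and y.\<close>

lemma s_word_surj:
  "w \<noteq> [] \<Longrightarrow> last w = Ly \<Longrightarrow> \<exists>ns. s_word ns = w \<and> (\<forall>n\<in>set ns. 1 \<le> n) \<and> ns \<noteq> []"
proof (induction w)
  case (Cons a v)
  show ?case
  proof (cases "v = []")
    case True
    with Cons have "s_word [1] = a # v" by (simp add: s_word_def)
    then show ?thesis by (intro exI[of _ "[1]"]) simp
  next
    case False
    with Cons obtain n ns where ns: "s_word (n # ns) = v" "\<forall>n\<in>set (n # ns). 1 \<le> n"
      by (metis last_ConsR neq_Nil_conv)
    show ?thesis
    proof (cases a)
      case Lx
      with ns have "s_word (Suc n # ns) = a # v"
        by (cases n) (simp_all add: s_word_Cons)
      with ns show ?thesis by (intro exI[of _ "Suc n # ns"]) simp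
    next
      case Ly
      with ns have "s_word (1 # n # ns) = a # v"
        by (simp add: s_word_Cons)
      with ns show ?thesis by (intro exI[of _ "1 # n # ns"]) simp
    qed
  qed
qed simp

lemma xy_word_val_finite:
  assumes "w \<noteq> []" "hd w = Lx" "last w = Ly"
  shows "xy.word_val w UNIV < top"
proof -
  obtain ns where ns: "s_word ns = w" "\<forall>n\<in>set ns. 1 \<le> n" "ns \<noteq> []"
    using s_word_surj assms by blast
  \<comment> \<open>A first letter 1 would make the word begin with y.\<close>
  have "hd ns \<noteq> 1"
    using ns assms(2) by (cases ns) (auto simp: s_word_Cons)
  then show ?thesis
    using xy_word_val_s_word[OF ns(2)] zN_word_val_finite[OF ns(2)] ns(1) by simp
qed

section \<open>From values of words back to zeta values of trees\<close>

lemma zeta_T_tree_flat1: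
  assumes "\<forall>d\<in>set_ptree t. 1 \<le> d" "rootdec t \<noteq> 1"
  shows "zeta_T_tree t = lin_val (\<lambda>w. enn2real (zN.word_val w UNIV)) (flat1_tree t)"
proof -
  \<comment> \<open>Only the support of the flattening matters here, so coefficients are taken in
    all of the reals.\<close>
  have "real_subfield UNIV"
    by (simp add: real_subfield_def)
  then have "Poly_Mapping.keys (flat1_tree t) \<subseteq> {w. set w \<subseteq> {1..} \<and> w \<noteq> [] \<and> hd w = rootdec t}"
    using flat1_tree_free_space[OF _ assms(1)] unfolding free_space_def by blast
  then have "zN.word_val w UNIV < top" if "w \<in> Poly_Mapping.keys (flat1_tree t)" for w
    using that assms(2) by (intro zN_word_val_finite) auto
  then show ?thesis
    unfolding zeta_T_tree_eq zN.tree_val_flat1[OF zN.lower_UNIV]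
    by (intro enn2real_ennval nonneg_lc_flat1_tree)
qed

lemma zeta_sh_T_tree_flat0:
  assumes "rootdec t = Lx" "\<forall>v\<in>leaves t. dec t v = Ly"
  shows "zeta_sh_T_tree t = lin_val (\<lambda>w. enn2real (xy.word_val w UNIV)) (flat0_tree t)"
proof -
  have "real_subfield UNIV"
    by (simp add: real_subfield_def)
  then have "Poly_Mapping.keys (flat0_tree t) \<subseteq> {w. w \<noteq> [] \<and> hd w = rootdec t \<and> last w = Ly}"
    using flat0_tree_free_space[OF _ assms(2)] unfolding free_space_def by blast
  then have "xy.word_val w UNIV < top" if "w \<in> Poly_Mapping.keys (flat0_tree t)" for w
    using that assms(1) by (intro xy_word_val_finite) auto
  then show ?thesis
    unfolding zeta_sh_T_tree_eq xy.tree_val_flat0[OF xy.lower_UNIV]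
    by (intro enn2real_ennval nonneg_lc_flat0_tree)
qed

lemma zeta_T_eq_zeta_sh_T_sPT:
  assumes K: "real_subfield K" and T: "T \<in> PT_N_conv K"
  shows "zeta_T T = zeta_sh_T (sPT T)"
proof -
  let ?Z = "\<lambda>w. enn2real (zN.word_val w UNIV)" and ?X = "\<lambda>w. enn2real (xy.word_val w UNIV)"
  have "zeta_T T = lin_val (\<lambda>t. lin_val ?Z (flat1_tree t)) T"
    unfolding zeta_T_def using T
    by (intro lin_val_cong zeta_T_tree_flat1) (auto simp: PT_N_conv_alt[OF K] free_space_def)
  also have "\<dots> = lin_val ?Z (flat1 T)"
    by (simp add: flat1_def lin_val_lin_ext)
  also have "\<dots> = lin_val (\<lambda>w. lin_val ?X (bvec (s_word w))) (flat1 T)"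
    using flat1_conv[OF K T]
    by (intro lin_val_cong) (auto simp: W_N_conv_def free_space_def subset_iff xy_word_val_s_word)
  also have "\<dots> = lin_val ?X (s_map (flat1 T))"
    by (simp only: s_map_def lin_val_lin_ext)
  \<comment> \<open>The commuting square leads from words back to binarised trees.\<close>
  also have "\<dots> = lin_val ?X (flat0 (sPT T))"
    by (simp only: flat0_sPT[OF K T])
  also have "\<dots> = lin_val (\<lambda>t. lin_val ?X (flat0_tree t)) (sPT T)"
    by (simp add: flat0_def lin_val_lin_ext)
  also have "\<dots> = zeta_sh_T (sPT T)"
    unfolding zeta_sh_T_def using sPT_conv[OF K T]
    by (intro lin_val_cong zeta_sh_T_tree_flat0[symmetric]) (auto simp: PT_xy_conv_def free_space_def)
  finally show ?thesis .
qed

theorem corollary45: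
  fixes K :: "real set"
  assumes "real_subfield K"
  shows "sPT \<in> PT_N_conv K \<rightarrow> PT_xy_conv K
    \<and> flat1 \<in> PT_N_conv K \<rightarrow> W_N_conv K
    \<and> flat0 \<in> PT_xy_conv K \<rightarrow> W_xy_conv K
    \<and> s_map \<in> W_N_conv K \<rightarrow> W_xy_conv K
    \<and> (\<forall>p\<in>PT_N_conv K. (flat0 \<circ> sPT) p = (s_map \<circ> flat1) p)
    \<and> (\<forall>T\<in>PT_N_conv K. zeta_T T = (zeta_sh_T \<circ> sPT) T)"
  using sPT_conv[OF assms] flat1_conv[OF assms] flat0_conv[OF assms] s_map_conv[OF assms]
    flat0_sPT[OF assms] zeta_T_eq_zeta_sh_T_sPT[OF assms]
  by auto

end
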